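(* Let $\ell$ be a positive integer and let $T_\ell=\{(m,n,\lambda)\mid \ell=mn\lambda,\ \gcd(m,n)=1,\ \lambda_2<\max\{\ell_2,2\}\}$, where $x_2$ denotes the $2$-part of an integer $x$. Let $(m,n,\lambda)\in T_\ell$. Then: (1) $|\mathcal{U}_\ell|=\ell$, i.e. there are exactly $\ell$ pairwise non-isomorphic unicellular regular dessins with face length $2\ell$; (2) $|\mathcal{K}_{m,n}^{(\lambda)}|=\phi(\lambda)\prod_{p\in\pi}\frac{p-2}{p-1}$ and $|\mathcal{U}_\ell^{(\lambda)}|=2^{|\sigma|}\phi(\lambda)\prod_{p\in\pi}\frac{p-2}{p-1}$, where $\sigma=\pi(\ell/\lambda)$ and $\pi=\pi(\lambda)\setminus\sigma$; (3) $|T_\ell|=(2e_1+\delta)(2e_2+1)\cdots(2e_s+1)$, where $\ell=p_1^{e_1}\cdots p_s^{e_s}$ is the prime factorization with $p_1<p_2<\dots<p_s$, and $\delta=0$ if $\ell$ is even and $\delta=1$ if $\ell$ is odd.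
   Context: A dessin is a 2-cell embedding of a connected bipartite (multi)graph with black and white vertices in a closed orientable surface; automorphisms preserve colours, incidence and orientation; it is regular if the automorphism group is transitive on edges; isomorphisms preserve colours. A dessin is unicellular if it has exactly one face; the face length is the number of edges on the boundary walk of a face. $\mathrm{K}_{m,n}^{(\lambda)}$ denotes the complete bipartite multigraph with $m$ black and $n$ white vertices, every black–white pair joined by exactly $\lambda$ edges. $\mathcal{U}_\ell$ is the set of isomorphism classes of unicellular regular dessins of face length $2\ell$; $\mathcal{U}_\ell^{(\lambda)}$ those whose underlying graph has edge multiplicity $\lambda$; $\mathcal{K}_{m,n}^{(\lambda)}$ those whose underlying (coloured) graph is $\mathrm{K}_{m,n}^{(\lambda)}$. $\pi(n)$ is the set of prime divisors of $n$ and $\phi$ is Euler's totient function. *)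

theory Defs
  imports "HOL-Combinatorics.Orbits" "HOL-Number_Theory.Totient"
begin

text \<open>
  A 2-cell embedding of a connected graph in a closed oriented surface is encoded, in the usual way
  (Heffter-Edmonds), by its rotation system: the graph together with, for every vertex, the
  cyclic order in which the edges follow each other around that vertex in the positive direction
  of the surface. For a bipartite multigraph every edge has exactly one black and one white end, so
  the rotations at all black vertices make up one permutation of the edges, and likewise for
  the white vertices.
\<close>

record ('b, 'w, 'e) embedded_graph =
  blacks :: "'b set"
  whites :: "'w set"
  edges :: "'e set"
  black_end :: "'e \<Rightarrow> 'b"
  white_end :: "'e \<Rightarrow> 'w"
  black_rot :: "'e \<Rightarrow> 'e"
  white_rot :: "'e \<Rightarrow> 'e"

definition vertices :: "('b, 'w, 'e) embedded_graph \<Rightarrow> ('b + 'w) set" where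
  "vertices D = blacks D <+> whites D"

definition adjacency :: "('b, 'w, 'e) embedded_graph \<Rightarrow> ('b + 'w) rel" where
  "adjacency D =
     (\<Union>e\<in>edges D. {(Inl (black_end D e), Inr (white_end D e)),
                   (Inr (white_end D e), Inl (black_end D e))})"

definition connected_graph :: "('b, 'w, 'e) embedded_graph \<Rightarrow> bool" where
  "connected_graph D \<longleftrightarrow> (\<forall>u\<in>vertices D. \<forall>v\<in>vertices D. (u, v) \<in> (adjacency D)\<^sup>*)"

text \<open>
  The edgeless graph with a single vertex is excluded. Being \<open>cyclic_on\<close> a set includes that the
  set is nonempty, which is no restriction here: a connected graph with an edge has no isolated
  vertices. Outside the edge set the rotations are the identity.
\<close>

definition dessin :: "('b, 'w, 'e) embedded_graph \<Rightarrow> bool" where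
  "dessin D \<longleftrightarrow>
     finite (blacks D) \<and> finite (whites D) \<and> finite (edges D) \<and> edges D \<noteq> {} \<and>
     black_end D ` edges D \<subseteq> blacks D \<and> white_end D ` edges D \<subseteq> whites D \<and>
     connected_graph D \<and>
     black_rot D permutes edges D \<and> white_rot D permutes edges D \<and>
     (\<forall>b\<in>blacks D. cyclic_on (black_rot D) {e \<in> edges D. black_end D e = b}) \<and>
     (\<forall>w\<in>whites D. cyclic_on (white_rot D) {e \<in> edges D. white_end D e = w})"

definition dessin_isomorphism ::
  "('b, 'w, 'e) embedded_graph \<Rightarrow> ('c, 'v, 'f) embedded_graph \<Rightarrow>
     ('b \<Rightarrow> 'c) \<Rightarrow> ('w \<Rightarrow> 'v) \<Rightarrow> ('e \<Rightarrow> 'f) \<Rightarrow> bool" where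
  "dessin_isomorphism D D' \<beta> \<omega> \<epsilon> \<longleftrightarrow>
     bij_betw \<beta> (blacks D) (blacks D') \<and>
     bij_betw \<omega> (whites D) (whites D') \<and>
     bij_betw \<epsilon> (edges D) (edges D') \<and>
     (\<forall>e\<in>edges D.
        black_end D' (\<epsilon> e) = \<beta> (black_end D e) \<and>
        white_end D' (\<epsilon> e) = \<omega> (white_end D e) \<and>
        black_rot D' (\<epsilon> e) = \<epsilon> (black_rot D e) \<and>
        white_rot D' (\<epsilon> e) = \<epsilon> (white_rot D e))"

definition isomorphic ::
  "('b, 'w, 'e) embedded_graph \<Rightarrow> ('c, 'v, 'f) embedded_graph \<Rightarrow> bool" where
  "isomorphic D D' \<longleftrightarrow> (\<exists>\<beta> \<omega> \<epsilon>. dessin_isomorphism D D' \<beta> \<omega> \<epsilon>)"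

definition regular :: "('b, 'w, 'e) embedded_graph \<Rightarrow> bool" where
  "regular D \<longleftrightarrow>
     (\<forall>e\<in>edges D. \<forall>e'\<in>edges D. \<exists>\<beta> \<omega> \<epsilon>. dessin_isomorphism D D \<beta> \<omega> \<epsilon> \<and> \<epsilon> e = e')"

text \<open>
  A dart \<open>(e, True)\<close> is the edge \<open>e\<close> traversed from its black to its white end, \<open>(e, False)\<close> the
  same edge traversed in the opposite direction. The boundary walk of a face, on arriving at a
  vertex, leaves along the edge that is next in the rotation at that vertex. An edge with the same
  face on both sides occurs twice on the boundary walk, once as each of its two darts.
\<close>

fun next_dart :: "('b, 'w, 'e) embedded_graph \<Rightarrow> 'e \<times> bool \<Rightarrow> 'e \<times> bool" where
  "next_dart D (e, True) = (white_rot D e, False)"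
| "next_dart D (e, False) = (black_rot D e, True)"

definition faces :: "('b, 'w, 'e) embedded_graph \<Rightarrow> ('e \<times> bool) set set" where
  "faces D = orbit (next_dart D) ` (edges D \<times> UNIV)"

definition unicellular :: "('b, 'w, 'e) embedded_graph \<Rightarrow> bool" where
  "unicellular D \<longleftrightarrow> card (faces D) = 1"

definition has_face_length :: "('b, 'w, 'e) embedded_graph \<Rightarrow> nat \<Rightarrow> bool" where
  "has_face_length D k \<longleftrightarrow> (\<forall>F\<in>faces D. card F = k)"

definition joining_edges :: "('b, 'w, 'e) embedded_graph \<Rightarrow> 'b \<Rightarrow> 'w \<Rightarrow> 'e set" where
  "joining_edges D b w = {e \<in> edges D. black_end D e = b \<and> white_end D e = w}"

definition has_edge_multiplicity :: "('b, 'w, 'e) embedded_graph \<Rightarrow> nat \<Rightarrow> bool" where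
  "has_edge_multiplicity D lam \<longleftrightarrow>
     (\<forall>b\<in>blacks D. \<forall>w\<in>whites D.
        joining_edges D b w \<noteq> {} \<longrightarrow> card (joining_edges D b w) = lam)"

definition underlying_complete_bipartite ::
  "('b, 'w, 'e) embedded_graph \<Rightarrow> nat \<Rightarrow> nat \<Rightarrow> nat \<Rightarrow> bool" where
  "underlying_complete_bipartite D m n lam \<longleftrightarrow>
     card (blacks D) = m \<and> card (whites D) = n \<and>
     (\<forall>b\<in>blacks D. \<forall>w\<in>whites D. card (joining_edges D b w) = lam)"

text \<open>
  Every dessin is finite, hence isomorphic to one whose vertices and edges are natural numbers, so
  isomorphism classes of dessins can be taken on these.
\<close>

type_synonym nat_dessin = "(nat, nat, nat) embedded_graph"

definition iso_rel :: "nat_dessin rel" where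
  "iso_rel = {(D, D'). dessin D \<and> dessin D' \<and> isomorphic D D'}"

lemma equiv_iso_rel: "equiv (Collect dessin) iso_rel"
proof (rule equivI)
  show "iso_rel \<subseteq> Collect dessin \<times> Collect dessin"
    by (auto simp: iso_rel_def)
  have "dessin_isomorphism D D id id id" for D :: nat_dessin
    by (simp add: dessin_isomorphism_def)
  then show "refl_on (Collect dessin) iso_rel"
    unfolding refl_on_def iso_rel_def isomorphic_def by blast
  show "sym iso_rel"
  proof (rule symI)
    fix D D' assume "(D, D') \<in> iso_rel"
    then obtain \<beta> \<omega> \<epsilon> where D: "dessin D" "dessin D'"
      and iso: "dessin_isomorphism D D' \<beta> \<omega> \<epsilon>"
      unfolding iso_rel_def isomorphic_def by blast
    let ?b = "inv_into (blacks D) \<beta>" and ?w = "inv_into (whites D) \<omega>"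
      and ?e = "inv_into (edges D) \<epsilon>"
    have inj: "inj_on \<beta> (blacks D)" "inj_on \<omega> (whites D)" "inj_on \<epsilon> (edges D)"
      and img: "\<epsilon> ` edges D = edges D'"
      using iso by (auto simp: dessin_isomorphism_def bij_betw_def)
    have mem: "black_end D e \<in> blacks D" "white_end D e \<in> whites D"
      "black_rot D e \<in> edges D" "white_rot D e \<in> edges D" if "e \<in> edges D" for e
      using D(1) that by (auto simp: dessin_def permutes_in_image)
    have "dessin_isomorphism D' D ?b ?w ?e"
      unfolding dessin_isomorphism_def
    proof (intro conjI ballI)
      show "bij_betw ?b (blacks D') (blacks D)" "bij_betw ?w (whites D') (whites D)"
        "bij_betw ?e (edges D') (edges D)"
        using iso by (auto simp: dessin_isomorphism_def bij_betw_inv_into)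
    next
      fix f assume "f \<in> edges D'"
      then obtain e where e: "e \<in> edges D" "f = \<epsilon> e" using img by blast
      with iso inj mem[OF e(1)] show
        "black_end D (?e f) = ?b (black_end D' f)" "white_end D (?e f) = ?w (white_end D' f)"
        "black_rot D (?e f) = ?e (black_rot D' f)" "white_rot D (?e f) = ?e (white_rot D' f)"
        by (simp_all add: dessin_isomorphism_def)
    qed
    with D show "(D', D) \<in> iso_rel" unfolding iso_rel_def isomorphic_def by blast
  qed
  show "trans iso_rel"
  proof (rule transI)
    fix D D' D'' assume "(D, D') \<in> iso_rel" "(D', D'') \<in> iso_rel"
    then obtain \<beta> \<omega> \<epsilon> \<beta>' \<omega>' \<epsilon>' where D: "dessin D" "dessin D''"
      and iso: "dessin_isomorphism D D' \<beta> \<omega> \<epsilon>" "dessin_isomorphism D' D'' \<beta>' \<omega>' \<epsilon>'"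
      unfolding iso_rel_def isomorphic_def by blast
    have "dessin_isomorphism D D'' (\<beta>' \<circ> \<beta>) (\<omega>' \<circ> \<omega>) (\<epsilon>' \<circ> \<epsilon>)"
      using iso unfolding dessin_isomorphism_def
      by (auto intro: bij_betw_trans dest: bij_betwE)
    with D show "(D, D'') \<in> iso_rel" unfolding iso_rel_def isomorphic_def by blast
  qed
qed

definition iso_classes :: "(nat_dessin \<Rightarrow> bool) \<Rightarrow> nat_dessin set set" where
  "iso_classes P = {D. dessin D \<and> P D} // iso_rel"

definition U :: "nat \<Rightarrow> nat_dessin set set" where
  "U l = iso_classes (\<lambda>D. unicellular D \<and> regular D \<and> has_face_length D (2 * l))"

definition U_mult :: "nat \<Rightarrow> nat \<Rightarrow> nat_dessin set set" where
  "U_mult l lam = iso_classes (\<lambda>D. unicellular D \<and> regular D \<and> has_face_length D (2 * l) \<and>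
     has_edge_multiplicity D lam)"

text \<open>
  No face length is prescribed here: the graph has \<open>m * n * lam\<close> edges, so the only face of a
  unicellular embedding has length \<open>2 * (m * n * lam)\<close>.
\<close>

definition K :: "nat \<Rightarrow> nat \<Rightarrow> nat \<Rightarrow> nat_dessin set set" where
  "K m n lam = iso_classes (\<lambda>D. unicellular D \<and> regular D \<and>
     underlying_complete_bipartite D m n lam)"

definition two_part :: "nat \<Rightarrow> nat" where
  "two_part x = 2 ^ multiplicity 2 x"

definition T :: "nat \<Rightarrow> (nat \<times> nat \<times> nat) set" where
  "T l = {(m, n, lam). l = m * n * lam \<and> coprime m n \<and> two_part lam < max (two_part l) 2}"

end

theory Submission
  imports Defs
begin

text \<open>
  The monodromy group of a regular dessin with \<open>l\<close> edges acts regularly on the edges. If the dessin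
  is unicellular, the product of the two rotations is an \<open>l\<close>-cycle and hence generates this group,
  which is therefore \<open>\<int> / l\<close>; identifying the product with the generator \<open>1\<close>, the dessin
  is given by a residue \<open>a\<close>, with the translations by \<open>- a\<close> and \<open>a + 1\<close> as rotations, and \<open>a\<close> is
  determined by the isomorphism class. Its graph is complete bipartite with \<open>gcd a l\<close> black and
  \<open>gcd (a + 1) l\<close> white vertices. The remaining counts are multiplicative in \<open>l\<close> by the Chinese
  remainder theorem and are evaluated at prime powers.
\<close>

section \<open>Unicellular regular dessins\<close>

text \<open>The condition in \<open>T\<close> and the factors in the formulas come from the same
  local fact at a prime p. If p divides \<open>m * n\<close>, it divides one of the consecutive
  numbers a and a + 1; the other is then automatically prime to p, a single gcd condition remains,
  and Euler's function counts its solutions. If p divides \<open>lam\<close> but not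
  \<open>m * n\<close>, both numbers must avoid p, which leaves p - 2 of the p - 1 unit classes:
  hence (p - 2) / (p - 1). This vanishes at p = 2, as one of a and a + 1 is even. So for even
  \<open>l\<close> a dessin can exist only with \<open>m * n\<close> even, and that is what the
  condition on 2-parts says. Fixing \<open>lam\<close> alone fixes only \<open>m * n\<close>, and
  each of its prime powers goes wholly to m or to n: hence the power of 2. The residue is an
  invariant because the product of the rotations is a distinguished generator: an isomorphism must
  carry 1 to 1, so no automorphism of the cyclic group can mix different residues.\<close>

lemma
  assumes "dessin D" "e \<in> edges D"
  shows black_end_in_blacks: "black_end D e \<in> blacks D"
    and white_end_in_whites: "white_end D e \<in> whites D"
    and black_rot_in_edges: "black_rot D e \<in> edges D"
    and white_rot_in_edges: "white_rot D e \<in> edges D"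
  using assms by (auto simp: dessin_def permutes_in_image)

section \<open>Vertex maps induced by edge maps\<close>

text \<open>The edges at one vertex form a single orbit of \<open>f\<close>, and a map that
  intertwines \<open>f\<close> with \<open>f'\<close> carries it into a single orbit of
  \<open>f'\<close>. The rotation data are left abstract so that the lemma serves both colours, and
  both a bijection and its inverse.\<close>

lemma end_eq_if_in_cycle:
  assumes E: "end ` E \<subseteq> V" and cyc: "\<forall>v\<in>V. cyclic_on f {e \<in> E. end e = v}"
    and E': "end' ` E' \<subseteq> V'" and cyc': "\<forall>v\<in>V'. cyclic_on f' {e \<in> E'. end' e = v}"
    and \<epsilon>: "\<epsilon> ` E \<subseteq> E'" "\<And>e. e \<in> E \<Longrightarrow> f' (\<epsilon> e) = \<epsilon> (f e)"
    and d: "d \<in> E" "e \<in> E" "end d = end e"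
  shows "end' (\<epsilon> d) = end' (\<epsilon> e)"
proof -
  let ?S = "{x \<in> E. end x = end d}" and ?S' = "{x \<in> E'. end' x = end' (\<epsilon> d)}"
  have S: "cyclic_on f ?S" using cyc E d(1) by blast
  have S': "cyclic_on f' ?S'" using cyc' E' \<epsilon>(1) d(1) by blast
  have "orbit f d = ?S" by (rule orbit_cyclic_eq3[OF S]) (use d(1) in auto)
  then have "e \<in> orbit f d" using d by auto
  then have "e \<in> E \<and> \<epsilon> e \<in> ?S'"
  proof induction
    case base
    have "f d \<in> ?S" "f' (\<epsilon> d) \<in> ?S'"
      using cyclic_on_inI[OF S, of d] cyclic_on_inI[OF S', of "\<epsilon> d"] \<epsilon>(1) d(1) by auto
    then show ?case using \<epsilon>(2)[OF d(1)] by auto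
  next
    case (step y)
    then have "y \<in> E" by blast
    then have "cyclic_on f {x \<in> E. end x = end y}" using cyc E by blast
    from cyclic_on_inI[OF this, of y] \<open>y \<in> E\<close> have "f y \<in> E" by auto
    moreover have "f' (\<epsilon> y) \<in> ?S'" using cyclic_on_inI[OF S'] step by blast
    ultimately show ?case using \<epsilon>(2)[OF \<open>y \<in> E\<close>] by auto
  qed
  then show ?thesis by auto
qed

text \<open>The vertices are the cycles of the rotations, so a map of edges that commutes with the
  rotations induces a map of vertices.\<close>

lemma ex_vertex_bijection:
  assumes E: "end ` E \<subseteq> V" and cyc: "\<forall>v\<in>V. cyclic_on f {e \<in> E. end e = v}"
    and E': "end' ` E' \<subseteq> V'" and cyc': "\<forall>v\<in>V'. cyclic_on f' {e \<in> E'. end' e = v}"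
    and bij: "bij_betw \<epsilon> E E'" and comm: "\<And>e. e \<in> E \<Longrightarrow> f' (\<epsilon> e) = \<epsilon> (f e)"
  shows "\<exists>\<beta>. bij_betw \<beta> V V' \<and> (\<forall>e\<in>E. end' (\<epsilon> e) = \<beta> (end e))"
proof -
  let ?\<epsilon>' = "inv_into E \<epsilon>"
  have inv: "?\<epsilon>' (\<epsilon> e) = e" if "e \<in> E" for e
    using that bij by (simp add: bij_betw_inv_into_left)
  have img: "\<epsilon> ` E = E'" using bij by (simp add: bij_betw_def)
  have img': "?\<epsilon>' ` E' \<subseteq> E" using bij bij_betw_inv_into bij_betw_imp_surj_on by blast
  have f_in: "f e \<in> E" if "e \<in> E" for e
    using cyclic_on_inI[of f "{x \<in> E. end x = end e}" e] that cyc E by auto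
  have "f (?\<epsilon>' y) = ?\<epsilon>' (f' y)" if "y \<in> E'" for y
  proof -
    from that obtain e where "e \<in> E" "y = \<epsilon> e" using img by blast
    then show ?thesis by (simp add: comm inv f_in)
  qed
  \<comment> \<open>The previous lemma for the inverse map; this becomes injectivity of the vertex
    map.\<close>
  then have reflects: "end x = end y" if "x \<in> E" "y \<in> E" "end' (\<epsilon> x) = end' (\<epsilon> y)" for x y
    using end_eq_if_in_cycle[OF E' cyc' E cyc img', of "\<epsilon> x" "\<epsilon> y"] that inv img by auto
  have forth: "end' (\<epsilon> x) = end' (\<epsilon> y)" if "x \<in> E" "y \<in> E" "end x = end y" for x y
    using end_eq_if_in_cycle[OF E cyc E' cyc' equalityD1[OF img] comm] that by blast
  \<comment> \<open>Any edge at \<open>v\<close> would do: \<open>forth\<close> makes the value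
    independent of the choice.\<close>
  define \<beta> where "\<beta> v = end' (\<epsilon> (SOME e. e \<in> E \<and> end e = v))" for v
  have \<beta>: "\<beta> (end e) = end' (\<epsilon> e)" if "e \<in> E" for e
  proof -
    have "(SOME x. x \<in> E \<and> end x = end e) \<in> E \<and> end (SOME x. x \<in> E \<and> end x = end e) = end e"
      by (rule someI[of _ e]) (use that in auto)
    then show ?thesis unfolding \<beta>_def using forth that by blast
  qed
  \<comment> \<open>No vertex is isolated, since \<open>cyclic_on\<close> includes
    nonemptiness.\<close>
  have V: "V = end ` E" using E cyc by (force simp: cyclic_on_def)
  have V': "V' = end' ` E'" using E' cyc' by (force simp: cyclic_on_def)
  have "inj_on \<beta> V" unfolding V by (auto intro!: inj_onI simp: \<beta> intro: reflects)
  moreover have "\<beta> ` V = V'" unfolding V V' img[symmetric] by (simp add: image_image \<beta>)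
  ultimately show ?thesis using \<beta> by (auto simp: bij_betw_def)
qed

text \<open>Reduces the construction of isomorphisms to edges, so that regularity and classification
  become statements about two permutations.\<close>

lemma dessin_isomorphism_if_edge_bijection:
  assumes "dessin D" "dessin D'" "bij_betw \<epsilon> (edges D) (edges D')"
    and "\<And>e. e \<in> edges D \<Longrightarrow> black_rot D' (\<epsilon> e) = \<epsilon> (black_rot D e)"
    and "\<And>e. e \<in> edges D \<Longrightarrow> white_rot D' (\<epsilon> e) = \<epsilon> (white_rot D e)"
  shows "\<exists>\<beta> \<omega>. dessin_isomorphism D D' \<beta> \<omega> \<epsilon>"
proof -
  have "\<exists>\<beta>. bij_betw \<beta> (blacks D) (blacks D') \<and>
      (\<forall>e\<in>edges D. black_end D' (\<epsilon> e) = \<beta> (black_end D e))"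
    by (rule ex_vertex_bijection[of _ _ _ "black_rot D" _ _ _ "black_rot D'"])
      (use assms in \<open>auto simp: dessin_def\<close>)
  moreover have "\<exists>\<omega>. bij_betw \<omega> (whites D) (whites D') \<and>
      (\<forall>e\<in>edges D. white_end D' (\<epsilon> e) = \<omega> (white_end D e))"
    by (rule ex_vertex_bijection[of _ _ _ "white_rot D" _ _ _ "white_rot D'"])
      (use assms in \<open>auto simp: dessin_def\<close>)
  ultimately show ?thesis using assms unfolding dessin_isomorphism_def by blast
qed

section \<open>Invariants of isomorphism and the number of edges\<close>

lemma card_joining_edges_isomorphic:
  assumes iso: "dessin_isomorphism D D' \<beta> \<omega> \<epsilon>" and D: "dessin D"
    and "b \<in> blacks D" "w \<in> whites D"
  shows "card (joining_edges D' (\<beta> b) (\<omega> w)) = card (joining_edges D b w)"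
proof -
  have inj: "inj_on \<beta> (blacks D)" "inj_on \<omega> (whites D)" "inj_on \<epsilon> (edges D)"
    and img: "\<epsilon> ` edges D = edges D'"
    using iso by (auto simp: dessin_isomorphism_def bij_betw_def)
  have "joining_edges D' (\<beta> b) (\<omega> w) = \<epsilon> ` joining_edges D b w"
    using iso assms(3,4) black_end_in_blacks[OF D] white_end_in_whites[OF D]
    unfolding joining_edges_def img[symmetric]
    by (auto simp: dessin_isomorphism_def inj_on_eq_iff[OF inj(1)] inj_on_eq_iff[OF inj(2)])
  moreover have "inj_on \<epsilon> (joining_edges D b w)"
    using inj(3) by (rule inj_on_subset) (auto simp: joining_edges_def)
  ultimately show ?thesis by (simp add: card_image)
qed

lemma finite_joining_edges: "dessin D \<Longrightarrow> finite (joining_edges D b w)"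
  by (simp add: dessin_def joining_edges_def)

lemma has_edge_multiplicity_isomorphic:
  assumes "isomorphic D D'" "dessin D" "dessin D'" "has_edge_multiplicity D' lam"
  shows "has_edge_multiplicity D lam"
proof -
  from assms(1) obtain \<beta> \<omega> \<epsilon> where iso: "dessin_isomorphism D D' \<beta> \<omega> \<epsilon>"
    by (auto simp: isomorphic_def)
  show ?thesis unfolding has_edge_multiplicity_def
  proof (intro ballI impI)
    fix b w assume bw: "b \<in> blacks D" "w \<in> whites D" "joining_edges D b w \<noteq> {}"
    then have "\<beta> b \<in> blacks D'" "\<omega> w \<in> whites D'"
      using iso by (auto simp: dessin_isomorphism_def bij_betw_def)
    moreover note card_joining_edges_isomorphic[OF iso assms(2) bw(1,2)]
    \<comment> \<open>The multiplicity of \<open>D'\<close> constrains adjacent pairs only; equal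
      nonzero cardinalities show that the image pair is adjacent.\<close>
    moreover have "card (joining_edges D b w) \<noteq> 0"
      using bw(3) finite_joining_edges[OF assms(2)] by simp
    ultimately show "card (joining_edges D b w) = lam"
      using assms(4) by (metis card.empty has_edge_multiplicity_def)
  qed
qed

lemma underlying_complete_bipartite_isomorphic:
  assumes "isomorphic D D'" "dessin D" "underlying_complete_bipartite D' m n lam"
  shows "underlying_complete_bipartite D m n lam"
proof -
  from assms(1) obtain \<beta> \<omega> \<epsilon> where iso: "dessin_isomorphism D D' \<beta> \<omega> \<epsilon>"
    by (auto simp: isomorphic_def)
  then have bij: "bij_betw \<beta> (blacks D) (blacks D')" "bij_betw \<omega> (whites D) (whites D')"
    by (auto simp: dessin_isomorphism_def)
  then show ?thesis
    using assms(3) bij_betw_same_card[OF bij(1)] bij_betw_same_card[OF bij(2)]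
      card_joining_edges_isomorphic[OF iso assms(2)]
    unfolding underlying_complete_bipartite_def by (metis bij_betwE)
qed

text \<open>Supplies the number of edges for \<open>K\<close>, where no face length is
  prescribed.\<close>

lemma card_edges_complete_bipartite:
  assumes D: "dessin D" and K: "underlying_complete_bipartite D m n lam"
  shows "card (edges D) = m * n * lam"
proof -
  let ?J = "\<lambda>(b, w). joining_edges D b w"
  have "edges D = (\<Union>x\<in>blacks D \<times> whites D. ?J x)"
    using black_end_in_blacks[OF D] white_end_in_whites[OF D] by (auto simp: joining_edges_def)
  also have "card \<dots> = (\<Sum>x\<in>blacks D \<times> whites D. card (?J x))"
    by (rule card_UN_disjoint)
      (use D in \<open>auto simp: joining_edges_def dessin_def\<close>)
  also have "\<dots> = (\<Sum>x\<in>blacks D \<times> whites D. lam)"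
    using K by (intro sum.cong) (auto simp: underlying_complete_bipartite_def)
  finally show ?thesis
    using K by (simp add: underlying_complete_bipartite_def card_cartesian_product)
qed

section \<open>Faces and the product of the rotations\<close>

lemma next_dart_orbit_subset:
  assumes "dessin D" "x \<in> edges D \<times> UNIV"
  shows "orbit (next_dart D) x \<subseteq> edges D \<times> UNIV"
proof
  have step: "next_dart D y \<in> edges D \<times> UNIV" if "y \<in> edges D \<times> UNIV" for y
    using that black_rot_in_edges[OF assms(1)] white_rot_in_edges[OF assms(1)]
    by (cases y; cases "snd y") auto
  fix y assume "y \<in> orbit (next_dart D) x"
  then show "y \<in> edges D \<times> UNIV" by induction (use assms step in auto)
qed

text \<open>Two steps along the face from \<open>(e, True)\<close> lead to the dart of \<open>black_rot D (white_rot D e)\<close>.\<close>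

lemma faces_of_cyclic_on:
  assumes D: "dessin D" and cyc: "cyclic_on (black_rot D \<circ> white_rot D) (edges D)"
  shows "faces D = {edges D \<times> UNIV}"
proof -
  let ?z = "black_rot D \<circ> white_rot D" and ?nd = "next_dart D"
  have True_sub: "edges D \<times> UNIV \<subseteq> orbit ?nd (e, True)" if e: "e \<in> edges D" for e
  proof -
    have T: "(x, True) \<in> orbit ?nd (e, True)" if "x \<in> edges D" for x
    proof -
      from that have "x \<in> orbit ?z e" using orbit_cyclic_eq3[OF cyc e] by simp
      then show ?thesis
      proof induction
        case base
        show ?case using orbit.step[OF orbit.base[of ?nd "(e, True)"]] by simp
      next
        case (step y)
        show ?case using orbit.step[OF orbit.step[OF step.IH]] by simp
      qed
    qed
    \<comment> \<open>Every dart into a black vertex directly follows a dart into a white one,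
      because \<open>white_rot D\<close> is onto the edges.\<close>
    have "(x, False) \<in> orbit ?nd (e, True)" if "x \<in> edges D" for x
    proof -
      have "white_rot D ` edges D = edges D"
        using D by (simp add: dessin_def permutes_image)
      then obtain y where "y \<in> edges D" "x = white_rot D y" using \<open>x \<in> edges D\<close> by blast
      then show ?thesis using orbit.step[OF T[of y]] by simp
    qed
    with T show ?thesis by (metis (full_types) SigmaE subsetI)
  qed
  have sub: "orbit f (f x) \<subseteq> orbit f x" for f :: "'x \<Rightarrow> 'x" and x
  proof
    fix y assume "y \<in> orbit f (f x)"
    then show "y \<in> orbit f x" by induction (auto intro: orbit.intros)
  qed
  have "orbit ?nd x = edges D \<times> UNIV" if x: "x \<in> edges D \<times> UNIV" for x
  proof
    show "orbit ?nd x \<subseteq> edges D \<times> UNIV" by (rule next_dart_orbit_subset[OF D x])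
    obtain e c where ec: "x = (e, c)" "e \<in> edges D" using x by auto
    show "edges D \<times> UNIV \<subseteq> orbit ?nd x"
    proof (cases c)
      case True
      then show ?thesis using True_sub ec by simp
    next
      case False
      then have "edges D \<times> UNIV \<subseteq> orbit ?nd (?nd x)"
        using True_sub black_rot_in_edges[OF D ec(2)] ec by simp
      then show ?thesis using sub[of ?nd x] by blast
    qed
  qed
  moreover have "edges D \<times> (UNIV :: bool set) \<noteq> {}" using D by (auto simp: dessin_def)
  ultimately show ?thesis unfolding faces_def by (simp add: image_constant_conv)
qed

lemma unicellular_iff_cyclic_on:
  assumes D: "dessin D"
  shows "unicellular D \<longleftrightarrow> cyclic_on (black_rot D \<circ> white_rot D) (edges D)"
proof
  let ?z = "black_rot D \<circ> white_rot D" and ?nd = "next_dart D"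
  assume "unicellular D"
  then obtain F where F: "faces D = {F}"
    by (auto simp: unicellular_def card_1_singleton_iff)
  then have orb: "orbit ?nd x = F" if "x \<in> edges D \<times> UNIV" for x
    using that unfolding faces_def by blast
  obtain e where e: "e \<in> edges D" using D by (auto simp: dessin_def)
  have "x \<in> orbit ?z e" if x: "x \<in> edges D" for x
  proof -
    have "black_rot D ` edges D = edges D"
      using D by (simp add: dessin_def permutes_image)
    then obtain y where y: "y \<in> edges D" "x = black_rot D y" using x by blast
    \<comment> \<open>By definition \<open>orbit\<close> collects only positive iterates; exhibiting
      the dart as a successor puts it on the face.\<close>
    have "(x, True) \<in> orbit ?nd (y, False)" using y orbit.base[of ?nd "(y, False)"] by simp
    also have "\<dots> = orbit ?nd (e, True)" using orb y e by simp
    \<comment> \<open>Invariant along the face: \<open>?z\<close> advances once per two darts, so a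
      dart ending in \<open>False\<close> is judged by the edge of its successor.\<close>
    finally have "if snd (x, True) then fst (x, True) \<in> orbit ?z e
        else black_rot D (fst (x, True)) \<in> orbit ?z e"
    proof induction
      case base
      show ?case using orbit.base[of ?z e] by simp
    next
      case (step y)
      obtain x c where "y = (x, c)" by (cases y)
      then show ?case using step.IH orbit.step[of x ?z e] by (cases c) auto
    qed
    then show ?thesis by simp
  qed
  moreover have "orbit ?z e \<subseteq> edges D"
    using D e by (intro permutes_orbit_subset permutes_compose) (auto simp: dessin_def)
  ultimately show "cyclic_on ?z (edges D)" using e by (intro cyclic_on_singleI[of e]) auto
next
  assume "cyclic_on (black_rot D \<circ> white_rot D) (edges D)"
  then show "unicellular D" using faces_of_cyclic_on[OF D] by (simp add: unicellular_def)
qed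

text \<open>The only face contains both darts of every edge. Thus the face length
  \<open>2 * l\<close> in \<open>U\<close> and \<open>U_mult\<close> amounts to having
  \<open>l\<close> edges.\<close>

lemma has_face_length_unicellular_iff:
  assumes "dessin D" "unicellular D"
  shows "has_face_length D k \<longleftrightarrow> k = 2 * card (edges D)"
  using faces_of_cyclic_on[OF assms(1)] unicellular_iff_cyclic_on[OF assms(1)] assms(2)
  by (auto simp: has_face_length_def card_cartesian_product)

subsection \<open>Dessins of cyclic groups\<close>

text \<open>Translation by \<open>c\<close> on residues, extended by the identity because the
  rotations of a dessin must fix everything outside the edge set.\<close>

definition rotate_mod :: "nat \<Rightarrow> nat \<Rightarrow> nat \<Rightarrow> nat" where
  "rotate_mod l c e = (if e < l then (e + c) mod l else e)"

text \<open>The two rotations are the translations by \<open>- a\<close> and \<open>a + 1\<close> of \<open>\<int> / l\<close>, whose sum is the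
  generator \<open>1\<close>; the vertices are the cosets of the subgroups that they generate.\<close>

definition cyclic_dessin :: "nat \<Rightarrow> nat \<Rightarrow> nat_dessin" where
  "cyclic_dessin l a =
     \<lparr>blacks = {..<gcd a l}, whites = {..<gcd (Suc a) l}, edges = {..<l},
      black_end = (\<lambda>e. e mod gcd a l), white_end = (\<lambda>e. e mod gcd (Suc a) l),
      black_rot = rotate_mod l (l - a), white_rot = rotate_mod l (Suc a)\<rparr>"

lemma cyclic_dessin_simps [simp]:
  "blacks (cyclic_dessin l a) = {..<gcd a l}"
  "whites (cyclic_dessin l a) = {..<gcd (Suc a) l}"
  "edges (cyclic_dessin l a) = {..<l}"
  "black_end (cyclic_dessin l a) e = e mod gcd a l"
  "white_end (cyclic_dessin l a) e = e mod gcd (Suc a) l"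
  "black_rot (cyclic_dessin l a) = rotate_mod l (l - a)"
  "white_rot (cyclic_dessin l a) = rotate_mod l (Suc a)"
  by (simp_all add: cyclic_dessin_def)

lemma rotate_mod_less: "e < l \<Longrightarrow> rotate_mod l c e < l"
  by (simp add: rotate_mod_def)

lemma rotate_mod_rotate_mod: "rotate_mod l c (rotate_mod l d e) = rotate_mod l (c + d) e"
  by (auto simp: rotate_mod_def mod_simps ac_simps)

lemma rotate_mod_cong: "c mod l = d mod l \<Longrightarrow> rotate_mod l c = rotate_mod l d"
  by (auto simp: rotate_mod_def fun_eq_iff intro: mod_add_cong)

lemma bij_betw_rotate_mod: "bij_betw (rotate_mod l c) {..<l} {..<l}"
proof -
  have "inj_on (rotate_mod l c) {..<l}"
  proof (rule inj_onI)
    fix x y assume xy: "x \<in> {..<l}" "y \<in> {..<l}" "rotate_mod l c x = rotate_mod l c y"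
    then have "[x + c = y + c] (mod l)" by (simp add: rotate_mod_def cong_def)
    then have "[x = y] (mod l)" by (simp only: cong_add_rcancel_nat)
    with xy show "x = y" by (simp add: cong_def)
  qed
  moreover have "rotate_mod l c ` {..<l} \<subseteq> {..<l}" by (auto simp: rotate_mod_less)
  ultimately show ?thesis by (simp add: bij_betw_def endo_inj_surj)
qed

lemma rotate_mod_permutes: "rotate_mod l c permutes {..<l}"
  by (rule bij_imp_permutes[OF bij_betw_rotate_mod]) (simp add: rotate_mod_def)

lemma funpow_rotate_mod: "e < l \<Longrightarrow> (rotate_mod l c ^^ k) e = (e + k * c) mod l"
  by (induction k) (auto simp: rotate_mod_def mod_simps ac_simps)

text \<open>The multiples of \<open>c\<close> modulo \<open>l\<close> are those of
  \<open>gcd c l\<close>, by Bezout, so the cycles of the translation are the cosets of the subgroup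
  generated by the gcd.\<close>

lemma cyclic_on_rotate_mod:
  assumes l: "l > 0" and r: "r < gcd c l"
  shows "cyclic_on (rotate_mod l c) {e \<in> {..<l}. e mod gcd c l = r}"
proof (rule cyclic_on_singleI)
  let ?S = "{e \<in> {..<l}. e mod gcd c l = r}"
  have "gcd c l \<le> l" using l by (simp add: gcd_le2_nat)
  then have "r < l" using r by simp
  then show "r \<in> ?S" using r by simp
  show "?S = orbit (rotate_mod l c) r"
  proof
    show "?S \<subseteq> orbit (rotate_mod l c) r"
    proof
      fix e assume e: "e \<in> ?S"
      define j where "j = e div gcd c l"
      have ej: "e = r + gcd c l * j" using e by (auto simp: j_def)
      obtain x where "[c * x = gcd c l] (mod l)" using cong_solve_nat by blast
      then have "[r + c * x * j = r + gcd c l * j] (mod l)"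
        by (intro cong_add cong_mult cong_refl)
      \<comment> \<open>The additional \<open>l\<close> steps change nothing modulo \<open>l\<close>
        but make the exponent positive, as membership in \<open>orbit\<close> demands.\<close>
      then have "(r + (x * j + l) * c) mod l = e"
      proof -
        have "(r + (x * j + l) * c) mod l = (r + c * x * j + l * c) mod l"
          by (simp add: algebra_simps)
        also have "\<dots> = (r + c * x * j) mod l" by (rule mod_mult_self2)
        finally show ?thesis
          using \<open>[r + c * x * j = r + gcd c l * j] (mod l)\<close> e
          unfolding ej[symmetric] by (simp add: cong_def)
      qed
      then have "(rotate_mod l c ^^ (x * j + l)) r = e"
        using \<open>r < l\<close> by (simp only: funpow_rotate_mod)
      then show "e \<in> orbit (rotate_mod l c) r"
        unfolding orbit_altdef using l by force
    qed
    show "orbit (rotate_mod l c) r \<subseteq> ?S"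
    proof
      fix e assume "e \<in> orbit (rotate_mod l c) r"
      then obtain n where "e = (r + n * c) mod l"
        unfolding orbit_altdef using funpow_rotate_mod[OF \<open>r < l\<close>] by auto
      moreover have "n * c mod gcd c l = 0" by simp
      then have "(r + n * c) mod gcd c l = r" using r
        by (metis mod_add_right_eq add_0_right mod_less)
      ultimately show "e \<in> ?S" using l by (simp add: mod_mod_cancel)
    qed
  qed
qed

text \<open>The natural number \<open>l - a\<close> stands for the residue of - a, which generates
  the same subgroup as \<open>a\<close>.\<close>

lemma gcd_diff_modulus_nat: "a \<le> l \<Longrightarrow> gcd (l - a) l = gcd a (l::nat)"
  by (metis diff_diff_cancel diff_le_self gcd.commute gcd_diff2_nat)

lemma rotate_mod_mod_dvd:
  assumes "d dvd l" "d dvd c"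
  shows "rotate_mod l c e mod d = e mod d"
  using assms by (auto simp: rotate_mod_def mod_mod_cancel elim!: dvdE)

lemma dessin_cyclic_dessin:
  assumes a: "a < l"
  shows "dessin (cyclic_dessin l a)"
proof -
  let ?D = "cyclic_dessin l a"
  let ?R = "(adjacency ?D)\<^sup>*"
  have l: "l > 0" using a by simp
  have g: "gcd (l - a) l = gcd a l" using a by (simp add: gcd_diff_modulus_nat)
  have "gcd a l dvd l - a" by (metis g gcd_dvd1)
  then have b_end: "black_end ?D (black_rot ?D e) = black_end ?D e" for e
    by (simp add: rotate_mod_mod_dvd)
  have w_end: "white_end ?D (white_rot ?D e) = white_end ?D e" for e
    by (simp add: rotate_mod_mod_dvd)
  have adj: "(Inl (black_end ?D e), Inr (white_end ?D e)) \<in> ?R"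
    "(Inr (white_end ?D e), Inl (black_end ?D e)) \<in> ?R" if "e < l" for e
    using that by (auto simp: adjacency_def intro!: r_into_rtrancl)
  have from0: "(Inl (black_end ?D 0), Inl (black_end ?D e)) \<in> ?R"
    and to0: "(Inl (black_end ?D e), Inl (black_end ?D 0)) \<in> ?R" if "e < l" for e
  proof -
    have "(Inl (black_end ?D 0), Inl (black_end ?D e)) \<in> ?R \<and>
      (Inl (black_end ?D e), Inl (black_end ?D 0)) \<in> ?R"
      using that
    proof (induction e)
      case (Suc e)
      \<comment> \<open>Connectedness comes from the product of the rotations being translation by
        1: \<open>f\<close> shares its white end with \<open>e\<close> and, one black rotation
        later, its black end with \<open>Suc e\<close>. So consecutive edges have black ends linked
        through a white vertex.\<close>
      define f where "f = white_rot ?D e"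
      have f: "f < l" using Suc.prems by (simp add: f_def rotate_mod_less)
      have "black_rot ?D f = rotate_mod l (l - a + Suc a) e"
        unfolding f_def by (simp add: rotate_mod_rotate_mod)
      also have "\<dots> = (Suc e + l) mod l" using Suc.prems a by (simp add: rotate_mod_def)
      also have "\<dots> = Suc e" using Suc.prems by (simp only: mod_add_self2 mod_less)
      finally have "black_end ?D f = black_end ?D (Suc e)" using b_end[of f] by simp
      moreover have "white_end ?D f = white_end ?D e" unfolding f_def by (rule w_end)
      ultimately have "(Inl (black_end ?D e), Inl (black_end ?D (Suc e))) \<in> ?R"
        "(Inl (black_end ?D (Suc e)), Inl (black_end ?D e)) \<in> ?R"
        using adj[of e] adj[OF f] Suc.prems by (metis Suc_lessD rtrancl_trans)+
      then show ?case using Suc by (meson Suc_lessD rtrancl_trans)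
    qed simp
    then show "(Inl (black_end ?D 0), Inl (black_end ?D e)) \<in> ?R"
      "(Inl (black_end ?D e), Inl (black_end ?D 0)) \<in> ?R" by auto
  qed
  have vert: "(Inl (black_end ?D 0), v) \<in> ?R \<and> (v, Inl (black_end ?D 0)) \<in> ?R"
    if "v \<in> vertices ?D" for v
  proof -
    have le: "gcd a l \<le> l" "gcd (Suc a) l \<le> l" using l by (simp_all add: gcd_le2_nat)
    from that consider e where "e < gcd a l" "v = Inl e" | e where "e < gcd (Suc a) l" "v = Inr e"
      by (auto simp: vertices_def)
    then show ?thesis
    proof cases
      case 1
      then show ?thesis using from0[of e] to0[of e] le by simp
    next
      case 2
      then have "v = Inr (white_end ?D e)" "e < l" using le by auto
      then show ?thesis using from0[of e] to0[of e] adj[of e] by (metis rtrancl_trans)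
    qed
  qed
  have "connected_graph ?D"
    unfolding connected_graph_def using vert by (meson rtrancl_trans)
  moreover have "\<forall>b\<in>blacks ?D. cyclic_on (black_rot ?D) {e \<in> edges ?D. black_end ?D e = b}"
    using cyclic_on_rotate_mod[OF l, of _ "l - a"] unfolding g by auto
  moreover have "\<forall>w\<in>whites ?D. cyclic_on (white_rot ?D) {e \<in> edges ?D. white_end ?D e = w}"
    using cyclic_on_rotate_mod[OF l, of _ "Suc a"] by auto
  ultimately show ?thesis
    unfolding dessin_def using l by (auto simp: rotate_mod_permutes)
qed

lemma rotate_mod_generator:
  assumes "a < l"
  shows "rotate_mod l (l - a) (rotate_mod l (Suc a) e) = rotate_mod l 1 e"
proof -
  have "l - a + Suc a = 1 + l" using assms by simp
  then have "rotate_mod l (l - a + Suc a) = rotate_mod l 1"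
    by (intro rotate_mod_cong) (simp only: mod_add_self2)
  then show ?thesis by (simp only: rotate_mod_rotate_mod)
qed

lemma unicellular_cyclic_dessin:
  assumes "a < l"
  shows "unicellular (cyclic_dessin l a)"
proof -
  have "black_rot (cyclic_dessin l a) \<circ> white_rot (cyclic_dessin l a) = rotate_mod l 1"
    using rotate_mod_generator[OF assms] by (simp add: fun_eq_iff)
  moreover have "cyclic_on (rotate_mod l 1) (edges (cyclic_dessin l a))"
    using cyclic_on_rotate_mod[of l 0 1] assms by (simp add: lessThan_def)
  ultimately show ?thesis
    by (simp only: unicellular_iff_cyclic_on[OF dessin_cyclic_dessin[OF assms]])
qed

text \<open>Translations commute with both rotations, hence are automorphisms, and they are
  transitive on the residues.\<close>

lemma regular_cyclic_dessin:
  assumes a: "a < l"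
  shows "regular (cyclic_dessin l a)"
  unfolding regular_def
proof (intro ballI)
  let ?D = "cyclic_dessin l a"
  fix e e' assume e: "e \<in> edges ?D" "e' \<in> edges ?D"
  \<comment> \<open>Translation by e' - e, written without truncated subtraction.\<close>
  let ?\<epsilon> = "rotate_mod l (e' + (l - e))"
  have "\<exists>\<beta> \<omega>. dessin_isomorphism ?D ?D \<beta> \<omega> ?\<epsilon>"
    by (rule dessin_isomorphism_if_edge_bijection)
      (simp_all add: a dessin_cyclic_dessin bij_betw_rotate_mod rotate_mod_rotate_mod add.commute)
  moreover have "?\<epsilon> e = e'" using e by (simp add: rotate_mod_def)
  ultimately show "\<exists>\<beta> \<omega> \<epsilon>. dessin_isomorphism ?D ?D \<beta> \<omega> \<epsilon> \<and> \<epsilon> e = e'" by blast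
qed

section \<open>The residue as a complete invariant\<close>

text \<open>An isomorphism commutes with the product of the rotations, translation by 1, and is
  therefore itself a translation. Translations commute with each other, so the white rotations must
  agree.\<close>

lemma cyclic_dessin_isomorphic_imp_eq:
  assumes a: "a < l" "a' < l" and iso: "isomorphic (cyclic_dessin l a) (cyclic_dessin l a')"
  shows "a = a'"
proof -
  from iso obtain \<beta> \<omega> \<epsilon> where
    iso: "dessin_isomorphism (cyclic_dessin l a) (cyclic_dessin l a') \<beta> \<omega> \<epsilon>"
    by (auto simp: isomorphic_def)
  then have \<epsilon>: "\<epsilon> e < l" "rotate_mod l (l - a') (\<epsilon> e) = \<epsilon> (rotate_mod l (l - a) e)"
    "rotate_mod l (Suc a') (\<epsilon> e) = \<epsilon> (rotate_mod l (Suc a) e)" if "e < l" for e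
    using that by (auto simp: dessin_isomorphism_def bij_betw_def)
  have step: "\<epsilon> (rotate_mod l 1 e) = rotate_mod l 1 (\<epsilon> e)" if "e < l" for e
  proof -
    have "rotate_mod l (l - a') (rotate_mod l (Suc a') (\<epsilon> e)) =
        rotate_mod l (l - a') (\<epsilon> (rotate_mod l (Suc a) e))"
      using \<epsilon>(3)[OF that] by simp
    also have "\<dots> = \<epsilon> (rotate_mod l (l - a) (rotate_mod l (Suc a) e))"
      by (rule \<epsilon>(2)) (rule rotate_mod_less[OF that])
    finally show ?thesis by (simp only: rotate_mod_generator[OF a(1)] rotate_mod_generator[OF a(2)])
  qed
  have "\<epsilon> (k mod l) = (\<epsilon> 0 + k) mod l" for k
  proof (induction k)
    case 0
    show ?case using \<epsilon>(1)[of 0] a by simp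
  next
    case (Suc k)
    have "k mod l < l" using a by simp
    from step[OF this] show ?case
      using Suc a by (simp add: rotate_mod_def mod_simps)
  qed
  moreover have "rotate_mod l (Suc a') (\<epsilon> 0) = \<epsilon> (rotate_mod l (Suc a) 0)"
    using \<epsilon>(3)[of 0] a by simp
  then have "(\<epsilon> 0 + Suc a') mod l = \<epsilon> (Suc a mod l)"
    using a \<epsilon>(1)[of 0] by (simp add: rotate_mod_def)
  ultimately have "(\<epsilon> 0 + Suc a') mod l = (\<epsilon> 0 + Suc a) mod l" by metis
  then have "[(\<epsilon> 0 + 1) + a' = (\<epsilon> 0 + 1) + a] (mod l)" by (simp add: cong_def)
  then have "[a' = a] (mod l)" by (simp only: cong_add_lcancel_nat)
  with a show ?thesis by (simp add: cong_def)
qed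

text \<open>An automorphism moving an edge along the face agrees with \<open>black_rot D \<circ> white_rot D\<close>
  everywhere, so the rotations commute with this cyclic permutation and are powers of it.\<close>

lemma isomorphic_cyclic_dessin:
  assumes D: "dessin D" and uni: "unicellular D" and reg: "regular D"
  shows "\<exists>a < card (edges D). isomorphic (cyclic_dessin (card (edges D)) a) D"
proof -
  define l where "l = card (edges D)"
  define z where "z = black_rot D \<circ> white_rot D"
  have cyc: "cyclic_on z (edges D)"
    using unicellular_iff_cyclic_on[OF D] uni by (simp add: z_def)
  obtain e0 where e0: "e0 \<in> edges D" using D by (auto simp: dessin_def)
  \<comment> \<open>Numbers the edges along the cycle of \<open>z\<close>; the period is
    \<open>l\<close>, so \<open>\<psi>\<close> identifies the residues modulo \<open>l\<close> with
    the edges.\<close>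
  define \<psi> where "\<psi> k = (z ^^ k) e0" for k
  have orb: "orbit z e0 = edges D" by (rule orbit_cyclic_eq3[OF cyc e0])
  then have self: "e0 \<in> orbit z e0" using e0 by simp
  define d where "d = funpow_dist1 z e0 e0"
  have inj: "inj_on \<psi> {0..<d}"
    using inj_on_funpow_dist1[OF self] by (simp add: \<psi>_def[abs_def] d_def)
  have img: "\<psi> ` {0..<d} = edges D"
    using orbit_conv_funpow_dist1[OF self] orb by (simp add: \<psi>_def d_def)
  have "d = l" unfolding l_def using card_image[OF inj] img by simp
  then have bij: "bij_betw \<psi> {..<l} (edges D)"
    using inj img by (simp add: bij_betw_def lessThan_atLeast0)
  have "\<psi> l = e0" using funpow_dist1_prop[OF self] unfolding d_def[symmetric] \<open>d = l\<close> \<psi>_def .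
  then have \<psi>_mod: "\<psi> (k mod l) = \<psi> k" for k
    unfolding \<psi>_def by (rule funpow_mod_eq)
  have l: "l > 0" using D by (auto simp: l_def dessin_def card_gt_0_iff)
  have \<psi>_in: "\<psi> k \<in> edges D" for k
    unfolding \<psi>_def by (rule cyclic_on_funpow_in[OF cyc e0])
  have \<psi>_Suc: "z (\<psi> k) = \<psi> (Suc k)" for k by (simp add: \<psi>_def)
  have z_in: "z e \<in> edges D" if "e \<in> edges D" for e using that by (rule cyclic_on_inI[OF cyc])
  obtain \<beta> \<omega> \<epsilon> where iso: "dessin_isomorphism D D \<beta> \<omega> \<epsilon>" and \<epsilon>0: "\<epsilon> e0 = z e0"
    using reg e0 z_in[OF e0] unfolding regular_def by blast
  have \<epsilon>: "black_rot D (\<epsilon> e) = \<epsilon> (black_rot D e)" "white_rot D (\<epsilon> e) = \<epsilon> (white_rot D e)"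
    if "e \<in> edges D" for e
    using iso that by (auto simp: dessin_isomorphism_def)
  have "\<epsilon> (\<psi> k) = z (\<psi> k)" for k
  proof (induction k)
    case 0
    show ?case using \<epsilon>0 by (simp add: \<psi>_def)
  next
    case (Suc k)
    have "\<epsilon> (z (\<psi> k)) = z (\<epsilon> (\<psi> k))"
      using \<epsilon>[OF \<psi>_in] \<epsilon>[OF white_rot_in_edges[OF D \<psi>_in]] by (simp add: z_def)
    then show ?case using Suc by (simp add: \<psi>_Suc)
  qed
  then have \<epsilon>z: "\<epsilon> e = z e" if "e \<in> edges D" for e
  proof -
    from that obtain k where "e = \<psi> k" using img by blast
    with \<open>\<And>k. \<epsilon> (\<psi> k) = z (\<psi> k)\<close> show ?thesis by simp
  qed
  have power: "f (\<psi> k) = \<psi> (k + c)"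
    if "f e0 = \<psi> c" "\<And>e. e \<in> edges D \<Longrightarrow> f (z e) = z (f e)" for f c k
  proof (induction k)
    case 0
    show ?case using that(1) by (simp add: \<psi>_def)
  next
    case (Suc k)
    have "f (\<psi> (Suc k)) = z (f (\<psi> k))" using that(2)[OF \<psi>_in] by (simp add: \<psi>_Suc)
    then show ?case using Suc by (simp add: \<psi>_Suc)
  qed
  have comm: "black_rot D (z e) = z (black_rot D e)" "white_rot D (z e) = z (white_rot D e)"
    if "e \<in> edges D" for e
    using \<epsilon>[OF that] \<epsilon>z[OF that] \<epsilon>z[OF black_rot_in_edges[OF D that]]
      \<epsilon>z[OF white_rot_in_edges[OF D that]] by simp_all
  obtain c where c: "c < l" "black_rot D e0 = \<psi> c"
    using black_rot_in_edges[OF D e0] bij by (metis bij_betw_imp_surj_on image_iff lessThan_iff)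
  obtain b where b: "b < l" "white_rot D e0 = \<psi> b"
    using white_rot_in_edges[OF D e0] bij by (metis bij_betw_imp_surj_on image_iff lessThan_iff)
  have black: "black_rot D (\<psi> k) = \<psi> (k + c)" for k by (rule power) (use c comm in auto)
  have white: "white_rot D (\<psi> k) = \<psi> (k + b)" for k by (rule power) (use b comm in auto)
  \<comment> \<open>\<open>z\<close> moves \<open>e0\<close> by one step, and as the product of the
    rotations by \<open>b + c\<close> steps.\<close>
  have "\<psi> 1 = \<psi> (b + c)"
    using b(2) black[of b] by (simp add: \<psi>_def z_def)
  then have "\<psi> (1 mod l) = \<psi> ((b + c) mod l)" by (simp only: \<psi>_mod)
  then have bc: "[b + c = 1] (mod l)"
    using inj_onD[OF bij_betw_imp_inj_on[OF bij]] l by (fastforce simp: cong_def)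
  \<comment> \<open>The residue of - c; the outer \<open>mod\<close> matters for
    \<open>c = 0\<close>. With \<open>b + c\<close> congruent to 1, the white shift \<open>b\<close>
    becomes \<open>Suc a\<close>.\<close>
  define a where "a = (l - c) mod l"
  have a: "a < l" using l by (simp add: a_def)
  have ca: "[l - a = c] (mod l)"
    using c by (cases "c = 0") (auto simp: a_def cong_def)
  then have "[Suc a + (l - a) = Suc a + c] (mod l)" by (simp only: cong_add_lcancel_nat)
  moreover have "Suc a + (l - a) = 1 + l" using a by simp
  ultimately have "[Suc a + c = b + c] (mod l)"
    using bc by (simp only: cong_def mod_add_self2)
  then have ba: "[Suc a = b] (mod l)" by (simp only: cong_add_rcancel_nat)
  have \<psi>_cong: "\<psi> (i + j) = \<psi> ((i + k) mod l)" if "[k = j] (mod l)" for i j k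
  proof -
    have "(i + k) mod l = (i + j) mod l" using that cong_add_lcancel_nat by (simp add: cong_def)
    then show ?thesis by (simp add: \<psi>_mod)
  qed
  have "\<exists>\<beta> \<omega>. dessin_isomorphism (cyclic_dessin l a) D \<beta> \<omega> \<psi>"
  proof (rule dessin_isomorphism_if_edge_bijection)
    show "dessin (cyclic_dessin l a)" using a by (rule dessin_cyclic_dessin)
    show "dessin D" by (rule D)
    show "bij_betw \<psi> (edges (cyclic_dessin l a)) (edges D)" using bij by simp
    fix k assume "k \<in> edges (cyclic_dessin l a)"
    then show "black_rot D (\<psi> k) = \<psi> (black_rot (cyclic_dessin l a) k)"
      "white_rot D (\<psi> k) = \<psi> (white_rot (cyclic_dessin l a) k)"
      using \<psi>_cong[OF ca, of k] \<psi>_cong[OF ba, of k]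
      by (simp_all add: black white rotate_mod_def)
  qed
  then show ?thesis using a unfolding isomorphic_def l_def by blast
qed

text \<open>The cyclic dessins form a transversal of the isomorphism classes, which turns counting
  classes into counting residues. \<open>inv\<close> carries \<open>P\<close> from a member of a
  class to its representative.\<close>

lemma card_iso_classes:
  assumes P: "\<And>D. dessin D \<Longrightarrow> P D \<Longrightarrow> unicellular D \<and> regular D \<and> card (edges D) = l"
    and inv: "\<And>a D. a < l \<Longrightarrow> dessin D \<Longrightarrow> isomorphic (cyclic_dessin l a) D \<Longrightarrow> P D \<Longrightarrow>
      P (cyclic_dessin l a)"
  shows "card (iso_classes P) = card {a. a < l \<and> P (cyclic_dessin l a)}"
proof -
  let ?f = "\<lambda>a. iso_rel `` {cyclic_dessin l a}"
  let ?A = "{a. a < l \<and> P (cyclic_dessin l a)}"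
  have "inj_on ?f ?A"
  proof (rule inj_onI)
    fix a a' assume a: "a \<in> ?A" "a' \<in> ?A" "?f a = ?f a'"
    then have "(cyclic_dessin l a, cyclic_dessin l a') \<in> iso_rel"
      using eq_equiv_class[OF a(3) equiv_iso_rel] by (simp add: dessin_cyclic_dessin)
    with a show "a = a'" using cyclic_dessin_isomorphic_imp_eq by (auto simp: iso_rel_def)
  qed
  moreover have "?f ` ?A = iso_classes P"
  proof
    show "?f ` ?A \<subseteq> iso_classes P"
      by (auto simp: iso_classes_def dessin_cyclic_dessin intro!: quotientI)
    show "iso_classes P \<subseteq> ?f ` ?A"
    proof
      fix C assume "C \<in> iso_classes P"
      then obtain D where D: "dessin D" "P D" "C = iso_rel `` {D}"
        by (auto simp: iso_classes_def elim: quotientE)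
      with P obtain a where a: "a < l" "isomorphic (cyclic_dessin l a) D"
        using isomorphic_cyclic_dessin by metis
      then have "(cyclic_dessin l a, D) \<in> iso_rel"
        using D by (simp add: iso_rel_def dessin_cyclic_dessin)
      then have "C = ?f a" using D(3) equiv_class_eq[OF equiv_iso_rel] by simp
      then show "C \<in> ?f ` ?A" using a inv D by blast
    qed
  qed
  ultimately show ?thesis using card_image by fastforce
qed

section \<open>Counting residues and coprime pairs\<close>

text \<open>Splits off the full power of a prime at once, so that the cofactor is coprime to it: the
  form suited to multiplicative counts.\<close>

lemma coprime_prime_power_induct [consumes 1, case_names one mult]:
  fixes n :: nat
  assumes "n > 0" and "P 1"
    and "\<And>p e k. prime p \<Longrightarrow> e > 0 \<Longrightarrow> k > 0 \<Longrightarrow> \<not> p dvd k \<Longrightarrow> P k \<Longrightarrow> P (p ^ e * k)"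
  shows "P n"
  using \<open>n > 0\<close>
proof (induction n rule: less_induct)
  case (less n)
  show ?case
  proof (cases "n = 1")
    case True
    with assms(2) show ?thesis by simp
  next
    case False
    then obtain p where p: "prime p" "p dvd n" using prime_factor_nat by blast
    have "n \<noteq> 0" "\<not> is_unit p" using less.prems p(1) by auto
    from multiplicity_decompose'[OF this]
    obtain k where k: "n = p ^ multiplicity p n * k" "\<not> p dvd k" .
    have e: "multiplicity p n > 0"
      using p less.prems by (simp add: prime_multiplicity_gt_zero_iff)
    have "k > 0" using k(1) less.prems by (cases "k = 0") auto
    moreover have "1 < p ^ multiplicity p n" using e p(1) prime_gt_1_nat one_less_power by blast
    ultimately have "k < n" by (subst k(1)) simp
    with less.IH \<open>k > 0\<close> have "P k" by blast
    with assms(3)[OF p(1) e \<open>k > 0\<close> k(2)] k(1) show ?thesis by simp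
  qed
qed

lemma gcd_mult_coprime_nat:
  fixes a b c :: nat
  assumes "coprime b c"
  shows "gcd a (b * c) = gcd a b * gcd a c"
proof (rule dvd_antisym)
  obtain b' c' where "gcd a (b * c) = b' * c'" "b' dvd b" "c' dvd c"
    using division_decomp[OF gcd_dvd2[of a "b * c"]] by blast
  then show "gcd a (b * c) dvd gcd a b * gcd a c"
    by (metis dvd_mult_left dvd_mult_right gcd_dvd1 gcd_greatest mult_dvd_mono)
  have "coprime (gcd a b) (gcd a c)" using assms
    by (meson coprime_divisors gcd_dvd2)
  then show "gcd a b * gcd a c dvd gcd a (b * c)"
    by (simp add: divides_mult mult_dvd_mono)
qed

text \<open>The two factors are recovered from the product as its gcds with \<open>k\<close> and
  \<open>l\<close>.\<close>

lemma mult_eq_mult_iff_coprime_nat: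
  fixes a b c d k l :: nat
  assumes "coprime k l" "a dvd k" "c dvd k" "b dvd l" "d dvd l"
  shows "a * b = c * d \<longleftrightarrow> a = c \<and> b = d"
proof
  have *: "gcd (x * y) k = x" "gcd (x * y) l = y" if "x dvd k" "y dvd l" for x y
  proof -
    have "coprime k y" "coprime l x"
      using assms(1) that by (meson coprime_commute coprime_divisors dvd_refl)+
    then have "gcd (x * y) k = gcd x k" "gcd (x * y) l = gcd y l"
      by (simp_all only: gcd_mult_left_right_cancel gcd_mult_left_left_cancel)
    with that show "gcd (x * y) k = x" "gcd (x * y) l = y" by (simp_all add: gcd_nat.absorb1)
  qed
  assume "a * b = c * d"
  then show "a = c \<and> b = d" using *[of a b] *[of c d] assms by simp
qed auto

lemma card_residue_class:
  fixes d q r :: nat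
  assumes "r < d"
  shows "card {e. e < d * q \<and> e mod d = r} = q"
proof -
  have "bij_betw (\<lambda>j. r + d * j) {..<q} {e. e < d * q \<and> e mod d = r}"
  proof (rule bij_betw_byWitness[where f' = "\<lambda>e. e div d"])
    show "(\<lambda>j. r + d * j) ` {..<q} \<subseteq> {e. e < d * q \<and> e mod d = r}"
    proof safe
      fix j assume "j < q"
      then have "d * j + d \<le> d * q" by (metis Suc_leI mult_Suc_right mult_le_mono2 add.commute)
      then show "r + d * j < d * q" using assms by linarith
    qed (use assms in auto)
    show "(\<lambda>e. e div d) ` {e. e < d * q \<and> e mod d = r} \<subseteq> {..<q}"
      by (auto simp: less_mult_imp_div_less mult.commute)
  qed (use assms in auto)
  then show ?thesis by (simp add: bij_betw_same_card[symmetric])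
qed

lemma card_residues_mult_coprime:
  fixes k l :: nat
  assumes "coprime k l" "k > 0" "l > 0"
  shows "card {a. a < k * l \<and> P (a mod k) \<and> Q (a mod l)} =
    card {a. a < k \<and> P a} * card {a. a < l \<and> Q a}"
proof -
  let ?f = "\<lambda>a. (a mod k, a mod l)"
  let ?S = "{a. a < k * l \<and> P (a mod k) \<and> Q (a mod l)}"
  let ?T = "{a. a < k \<and> P a} \<times> {a. a < l \<and> Q a}"
  have "inj_on ?f ?S"
  proof (rule inj_onI)
    fix a b assume ab: "a \<in> ?S" "b \<in> ?S" "?f a = ?f b"
    from binary_chinese_remainder_unique_nat[of k l a a]
    show "a = b" using ab assms by (auto simp: cong_def)
  qed
  moreover have "?f ` ?S = ?T"
  proof
    show "?f ` ?S \<subseteq> ?T" using assms by auto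
    show "?T \<subseteq> ?f ` ?S"
    proof safe
      fix a b assume ab: "a < k" "P a" "b < l" "Q b"
      from binary_chinese_remainder_unique_nat[of k l a b] assms
      obtain x where "x < k * l" "[x = a] (mod k)" "[x = b] (mod l)" by auto
      with ab have "x \<in> ?S" "?f x = (a, b)" by (auto simp: cong_def)
      then show "(a, b) \<in> ?f ` ?S" by (rule_tac image_eqI[of _ _ x]) simp_all
    qed
  qed
  ultimately have "bij_betw ?f ?S ?T" by (simp add: bij_betw_def)
  from bij_betw_same_card[OF this] show ?thesis by (simp only: card_cartesian_product)
qed

section \<open>Residues with prescribed numbers of vertices\<close>

text \<open>These are the residues \<open>a\<close> for which \<open>cyclic_dessin l a\<close> has
  \<open>m\<close> black and \<open>n\<close> white vertices.\<close>

definition consecutive_gcds :: "nat \<Rightarrow> nat \<Rightarrow> nat \<Rightarrow> nat set" where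
  "consecutive_gcds l m n = {a. a < l \<and> gcd a l = m \<and> gcd (Suc a) l = n}"

lemma gcd_Suc_mod_nat: "gcd (Suc (a mod l)) l = gcd (Suc a) (l::nat)"
  by (metis gcd_red_nat gcd.commute mod_Suc_eq)

lemma card_consecutive_gcds_mult:
  assumes "coprime k l" "k > 0" "l > 0" "m1 dvd k" "m2 dvd l" "n1 dvd k" "n2 dvd l"
  shows "card (consecutive_gcds (k * l) (m1 * m2) (n1 * n2)) =
    card (consecutive_gcds k m1 n1) * card (consecutive_gcds l m2 n2)"
proof -
  have "consecutive_gcds (k * l) (m1 * m2) (n1 * n2) =
    {a. a < k * l \<and> (gcd (a mod k) k = m1 \<and> gcd (Suc (a mod k)) k = n1) \<and>
       (gcd (a mod l) l = m2 \<and> gcd (Suc (a mod l)) l = n2)}"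
    unfolding consecutive_gcds_def gcd_Suc_mod_nat
    by (auto simp: gcd_mult_coprime_nat[OF assms(1)]
        mult_eq_mult_iff_coprime_nat[OF assms(1)] assms)
  then show ?thesis
    using card_residues_mult_coprime[OF assms(1-3),
        of "\<lambda>a. gcd a k = m1 \<and> gcd (Suc a) k = n1" "\<lambda>a. gcd a l = m2 \<and> gcd (Suc a) l = n2"]
    by (simp add: consecutive_gcds_def)
qed

text \<open>The reflection of \<open>a\<close> to - 1 - a exchanges \<open>a\<close> and
  \<open>Suc a\<close> up to sign; on dessins it exchanges the colours.\<close>

lemma card_consecutive_gcds_commute:
  "card (consecutive_gcds l m n) = card (consecutive_gcds l n m)"
proof -
  have "gcd (l - Suc a) l = gcd (Suc a) l" "gcd (Suc (l - Suc a)) l = gcd a l" if "a < l" for a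
    using that by (simp_all add: Suc_diff_Suc gcd_diff2_nat[OF less_imp_le] gcd_diff2_nat Suc_leI)
  then have "bij_betw (\<lambda>a. l - Suc a) (consecutive_gcds l m n) (consecutive_gcds l n m)"
    by (intro bij_betw_byWitness[where f' = "\<lambda>a. l - Suc a"])
      (auto simp: consecutive_gcds_def)
  then show ?thesis by (rule bij_betw_same_card)
qed

lemma card_gcd_eq_totient_less:
  assumes "l > 0" "d dvd l"
  shows "card {a. a < l \<and> gcd a l = d} = totient (l div d)"
proof -
  \<comment> \<open>The known count runs over 1 to \<open>l\<close>; 0 and \<open>l\<close> have the
    same gcd with \<open>l\<close>.\<close>
  have "bij_betw (\<lambda>a. if a = 0 then l else a) {a. a < l \<and> gcd a l = d}
      {k\<in>{0<..l}. gcd k l = d}"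
    by (rule bij_betw_byWitness[where f' = "\<lambda>a. if a = l then 0 else a"])
      (use \<open>l > 0\<close> in \<open>auto split: if_splits\<close>)
  from bij_betw_same_card[OF this] show ?thesis
    using card_gcd_eq_totient[OF assms] by simp
qed

text \<open>Here \<open>p\<close> divides \<open>m\<close>, hence \<open>a\<close>, so
  \<open>Suc a\<close> is automatically prime to \<open>p\<close> and only the condition on
  \<open>a\<close> remains to be counted.\<close>

lemma card_consecutive_gcds_prime_power_left:
  assumes p: "prime p" and l: "p ^ e = m * lam" and m: "m \<noteq> 1"
  shows "card (consecutive_gcds (p ^ e) m 1) = totient lam"
proof -
  have "m > 0" using l p by (metis gr0I mult_0 power_eq_0_iff not_prime_0)
  have "m dvd p ^ e" using l by simp
  then have "p dvd m" using m p
    by (metis divides_primepow_nat dvd_power not_gr_zero power_0)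
  have "gcd (Suc a) (p ^ e) = 1" if "gcd a (p ^ e) = m" for a
  proof -
    have "p dvd a" using \<open>p dvd m\<close> that by (meson dvd_trans gcd_dvd1)
    then have "\<not> p dvd Suc a" using p by (metis Suc_eq_plus1 dvd_add_right_iff not_prime_unit)
    then show ?thesis using p
      by (metis coprime_commute coprime_iff_gcd_eq_1 prime_imp_power_coprime_nat)
  qed
  then have "consecutive_gcds (p ^ e) m 1 = {a. a < p ^ e \<and> gcd a (p ^ e) = m}"
    unfolding consecutive_gcds_def by auto
  moreover have "p ^ e > 0" using p by (simp add: prime_gt_0_nat)
  moreover have "p ^ e div m = lam" using l \<open>m > 0\<close> by simp
  ultimately show ?thesis
    using card_gcd_eq_totient_less[of "p ^ e" m] \<open>m dvd p ^ e\<close> by simp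
qed

text \<open>From the units one removes the class of - 1 modulo \<open>p\<close>, where
  \<open>Suc a\<close> is divisible by \<open>p\<close>. It takes up the fraction 1 / (p - 1) of the
  units; for \<open>p = 2\<close> nothing is left.\<close>

lemma card_consecutive_gcds_prime_power_unit:
  assumes p: "prime p" and e: "e > 0"
  shows "real (card (consecutive_gcds (p ^ e) 1 1)) =
    real (totient (p ^ e)) * ((real p - 2) / (real p - 1))"
proof -
  let ?A = "{a. a < p ^ e \<and> gcd a (p ^ e) = 1}" and ?B = "{a. a < p ^ e \<and> a mod p = p - 1}"
  obtain k where k: "e = Suc k" using e gr0_implies_Suc by blast
  have p1: "p > 1" using p prime_gt_1_nat by blast
  have "coprime a p \<longleftrightarrow> \<not> p dvd a" for a
    using p prime_imp_coprime_nat coprime_common_divisor not_prime_unit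
    by (metis coprime_commute dvd_refl)
  then have cop: "gcd a (p ^ e) = 1 \<longleftrightarrow> \<not> p dvd a" for a
    unfolding coprime_iff_gcd_eq_1[symmetric] using e by simp
  have "a mod p = p - 1 \<longleftrightarrow> p dvd Suc a" for a
    using p1 by (auto simp: dvd_eq_mod_eq_0 mod_Suc)
  then have eq: "consecutive_gcds (p ^ e) 1 1 = ?A - ?B"
    unfolding consecutive_gcds_def cop by auto
  have "?B \<subseteq> ?A" using p1 unfolding cop by (auto simp: dvd_eq_mod_eq_0)
  have "card ?B = p ^ k" using card_residue_class[of "p - 1" p "p ^ k"] p1 k by simp
  moreover have "card ?A = p ^ k * (p - 1)"
    using card_gcd_eq_totient_less[of "p ^ e" 1] p1 totient_prime_power_Suc[OF p] k by simp
  moreover have "card (?A - ?B) = card ?A - card ?B" "card ?B \<le> card ?A"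
    using \<open>?B \<subseteq> ?A\<close> by (auto intro!: card_Diff_subset card_mono)
  ultimately have "real (card (consecutive_gcds (p ^ e) 1 1)) =
      real p ^ k * (real p - 1) - real p ^ k"
    unfolding eq using p1 by (simp add: of_nat_diff)
  also have "\<dots> = real p ^ k * (real p - 2)"
    by (simp add: algebra_simps)
  also have "\<dots> = (real p ^ k * (real p - 1)) * ((real p - 2) / (real p - 1))"
    using p1 by simp
  also have "real p ^ k * (real p - 1) = real (totient (p ^ e))"
    using p1 totient_prime_power_Suc[OF p, of k] k by (simp add: of_nat_diff)
  finally show ?thesis .
qed

lemma card_consecutive_gcds_prime_power:
  assumes p: "prime p" and e: "e > 0" and l: "p ^ e = m * n * lam" and mn: "coprime m n"
  shows "real (card (consecutive_gcds (p ^ e) m n)) = real (totient lam) *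
    (\<Prod>q\<in>prime_factors lam - prime_factors (m * n). (real q - 2) / (real q - 1))"
proof -
  have "lam dvd p ^ e" "m dvd p ^ e" "n dvd p ^ e" using l by auto
  then obtain i j k where ijk: "lam = p ^ k" "m = p ^ i" "n = p ^ j"
    using p by (metis divides_primepow_nat)
  have sub: "prime_factors lam \<subseteq> {p}"
    using p ijk(1) by (cases "k = 0") (auto simp: prime_factors_power prime_factorization_prime)
  \<comment> \<open>Two coprime powers of \<open>p\<close> cannot both be nontrivial. The product
    over primes is nonempty only in the first case, as otherwise \<open>p\<close> divides
    \<open>m * n\<close>.\<close>
  consider "m = 1" "n = 1" | "m \<noteq> 1" "n = 1" | "m = 1" "n \<noteq> 1"
    using mn ijk p by (cases "i = 0"; cases "j = 0") auto
  then show ?thesis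
  proof cases
    case 1
    then have "lam = p ^ e" using l by simp
    then show ?thesis
      using card_consecutive_gcds_prime_power_unit[OF p e] 1 p e
      by (simp add: prime_factors_power prime_factorization_prime)
  next
    case 2
    then have "p \<in> prime_factors (m * n)"
      using ijk p by (cases "i = 0") (auto simp: in_prime_factors_iff)
    then have *: "prime_factors lam - prime_factors (m * n) = {}" using sub by blast
    show ?thesis
      using card_consecutive_gcds_prime_power_left[OF p _ 2(1), of e lam] l 2 unfolding * by simp
  next
    case 3
    then have "p \<in> prime_factors (m * n)"
      using ijk p by (cases "j = 0") (auto simp: in_prime_factors_iff)
    then have *: "prime_factors lam - prime_factors (m * n) = {}" using sub by blast
    show ?thesis
      using card_consecutive_gcds_prime_power_left[OF p _ 3(2), of e lam] l 3
        card_consecutive_gcds_commute[of "p ^ e" 1 n] unfolding * by simp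
  qed
qed

lemma coprime_mult_dvd_mult_decomp:
  fixes m n k l :: nat
  assumes "coprime k l" "coprime m n" "m * n dvd k * l"
  obtains m1 m2 n1 n2 where "m = m1 * m2" "n = n1 * n2" "coprime m1 n1" "coprime m2 n2"
    "m1 * n1 dvd k" "m2 * n2 dvd l"
proof -
  have "m dvd k * l" "n dvd k * l"
    using assms(3) by (auto elim: dvd_mult_left dvd_mult_right)
  then obtain m1 m2 n1 n2 where *: "m = m1 * m2" "m1 dvd k" "m2 dvd l"
    "n = n1 * n2" "n1 dvd k" "n2 dvd l"
    by (metis division_decomp)
  with assms(2) have "coprime m1 n1" "coprime m2 n2" by simp_all
  with * that show ?thesis by (simp add: divides_mult)
qed

theorem card_consecutive_gcds:
  assumes "l > 0" "l = m * n * lam" "coprime m n"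
  shows "real (card (consecutive_gcds l m n)) = real (totient lam) *
    (\<Prod>q\<in>prime_factors lam - prime_factors (m * n). (real q - 2) / (real q - 1))"
  using assms
proof (induction l arbitrary: m n lam rule: coprime_prime_power_induct)
  case one
  then have "m = 1" "n = 1" "lam = 1" by auto
  moreover have "consecutive_gcds 1 1 1 = {0}" by (auto simp: consecutive_gcds_def)
  ultimately show ?case by simp
next
  case (mult p e k)
  define r where "r = (\<lambda>q::nat. (real q - 2) / (real q - 1))"
  have cop: "coprime (p ^ e) k"
    using mult.hyps prime_imp_power_coprime_nat coprime_commute by blast
  have "m * n dvd p ^ e * k" using mult.prems by simp
  from coprime_mult_dvd_mult_decomp[OF cop mult.prems(2) this]
  obtain m1 m2 n1 n2 where mn: "m = m1 * m2" "n = n1 * n2" "coprime m1 n1" "coprime m2 n2"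
    and dvd: "m1 * n1 dvd p ^ e" "m2 * n2 dvd k" .
  then obtain lam1 lam2 where lam: "p ^ e = m1 * n1 * lam1" "k = m2 * n2 * lam2"
    by (elim dvdE)
  have pos: "p ^ e > 0" using mult.hyps by (simp add: prime_gt_0_nat)
  have "(m * n) * lam = (m * n) * (lam1 * lam2)"
    using mult.prems(1)[symmetric] unfolding lam mn by (simp only: mult_ac)
  moreover have "m * n \<noteq> 0" using mn lam pos \<open>k > 0\<close> by (metis mult_eq_0_iff not_gr_zero)
  ultimately have lam12: "lam = lam1 * lam2" by (metis mult_left_cancel)
  have nz: "m1 \<noteq> 0" "m2 \<noteq> 0" "n1 \<noteq> 0" "n2 \<noteq> 0" "lam1 \<noteq> 0" "lam2 \<noteq> 0"
    using lam pos \<open>k > 0\<close> by (auto intro!: Nat.gr0I)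
  have coplam: "coprime lam1 lam2" "coprime lam1 (m2 * n2)" "coprime lam2 (m1 * n1)"
    using cop unfolding lam by (auto simp: coprime_commute)
  have disj: "\<not> (q dvd a \<and> q dvd b)" if "prime q" "coprime a b" for q a b :: nat
    using that coprime_common_divisor not_prime_unit by blast
  let ?A = "prime_factors lam1 - prime_factors (m1 * n1)"
  let ?B = "prime_factors lam2 - prime_factors (m2 * n2)"
  \<comment> \<open>A prime of \<open>lam1\<close> cannot divide \<open>m2 * n2\<close>, nor a prime
    of \<open>lam2\<close> divide \<open>m1 * n1\<close>, so removing the primes of
    \<open>m * n\<close> can be done in each part separately.\<close>
  have "prime_factors lam - prime_factors (m * n) = ?A \<union> ?B"
    using nz disj[OF _ coplam(2)] disj[OF _ coplam(3)] unfolding lam12 mn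
    by (auto simp: in_prime_factors_iff prime_dvd_mult_iff)
  moreover have "?A \<inter> ?B = {}"
    using disj[OF _ coplam(1)] by (auto simp: in_prime_factors_iff)
  ultimately have prod: "prod r (prime_factors lam - prime_factors (m * n)) = prod r ?A * prod r ?B"
    by (simp add: prod.union_disjoint)
  have "card (consecutive_gcds (p ^ e * k) m n) =
      card (consecutive_gcds (p ^ e) m1 n1) * card (consecutive_gcds k m2 n2)"
    unfolding mn using dvd pos \<open>k > 0\<close>
    by (intro card_consecutive_gcds_mult[OF cop]) (auto elim: dvd_mult_left dvd_mult_right)
  moreover have "real (card (consecutive_gcds k m2 n2)) = real (totient lam2) * prod r ?B"
    using mult.IH[OF lam(2) mn(4)] by (simp add: r_def)
  moreover have "real (card (consecutive_gcds (p ^ e) m1 n1)) = real (totient lam1) * prod r ?A"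
    using card_consecutive_gcds_prime_power[OF mult.hyps(1,2) lam(1) mn(3)] by (simp add: r_def)
  ultimately show ?case
    using prod totient_mult_coprime[OF coplam(1)] lam12 by (simp add: r_def)
qed

section \<open>Coprime pairs of divisors\<close>

text \<open>The parameter \<open>R\<close> lets one multiplicativity proof serve two counts:
  equality gives the coprime factorizations of \<open>l div lam\<close>, and a parity condition
  gives \<open>T l\<close>.\<close>

definition coprime_divisor_pairs :: "(nat \<Rightarrow> nat \<Rightarrow> bool) \<Rightarrow> nat \<Rightarrow> (nat \<times> nat) set" where
  "coprime_divisor_pairs R k = {(m, n). coprime m n \<and> m * n dvd k \<and> R k (m * n)}"

lemma card_coprime_divisor_pairs_mult:
  assumes cop: "coprime k l"
    and R: "\<And>c d. c dvd k \<Longrightarrow> d dvd l \<Longrightarrow> R (k * l) (c * d) \<longleftrightarrow> R k c \<and> R l d"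
  shows "card (coprime_divisor_pairs R (k * l)) =
    card (coprime_divisor_pairs R k) * card (coprime_divisor_pairs R l)"
proof -
  let ?f = "\<lambda>((m1, n1), (m2, n2)). (m1 * m2, n1 * n2)"
  let ?S = "coprime_divisor_pairs R k \<times> coprime_divisor_pairs R l"
  have "inj_on ?f ?S"
  proof (rule inj_onI)
    fix x y assume xy: "x \<in> ?S" "y \<in> ?S" "?f x = ?f y"
    obtain a b c d a' b' c' d' where eq: "x = ((a, b), (c, d))" "y = ((a', b'), (c', d'))"
      by (metis surj_pair)
    have "a dvd k" "b dvd k" "a' dvd k" "b' dvd k" "c dvd l" "d dvd l" "c' dvd l" "d' dvd l"
      using xy(1,2) unfolding eq coprime_divisor_pairs_def
      by (auto dest: dvd_mult_left dvd_mult_right)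
    moreover have "a * c = a' * c'" "b * d = b' * d'" using xy(3) unfolding eq by auto
    ultimately show "x = y"
      unfolding eq by (simp add: mult_eq_mult_iff_coprime_nat[OF cop])
  qed
  moreover have "?f ` ?S = coprime_divisor_pairs R (k * l)"
  proof
    show "?f ` ?S \<subseteq> coprime_divisor_pairs R (k * l)"
    proof safe
      fix m1 n1 m2 n2
      assume a: "(m1, n1) \<in> coprime_divisor_pairs R k" "(m2, n2) \<in> coprime_divisor_pairs R l"
      then have d: "m1 * n1 dvd k" "m2 * n2 dvd l" by (auto simp: coprime_divisor_pairs_def)
      then have "coprime (m1 * n1) (m2 * n2)" using cop by (meson coprime_divisors)
      then have "coprime (m1 * m2) (n1 * n2)"
        using a by (auto simp: coprime_divisor_pairs_def coprime_commute)
      moreover have "(m1 * m2) * (n1 * n2) = (m1 * n1) * (m2 * n2)" by simp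
      ultimately show "(m1 * m2, n1 * n2) \<in> coprime_divisor_pairs R (k * l)"
        using a d R[OF d] unfolding coprime_divisor_pairs_def
        by (metis (mono_tags, lifting) case_prodD case_prodI mem_Collect_eq mult_dvd_mono)
    qed
    show "coprime_divisor_pairs R (k * l) \<subseteq> ?f ` ?S"
    proof safe
      fix m n assume "(m, n) \<in> coprime_divisor_pairs R (k * l)"
      then have a: "coprime m n" "m * n dvd k * l" "R (k * l) (m * n)"
        by (auto simp: coprime_divisor_pairs_def)
      from coprime_mult_dvd_mult_decomp[OF cop a(1,2)]
      obtain m1 m2 n1 n2 where *: "m = m1 * m2" "n = n1 * n2" "coprime m1 n1" "coprime m2 n2"
        "m1 * n1 dvd k" "m2 * n2 dvd l" .
      have "m * n = (m1 * n1) * (m2 * n2)" using * by simp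
      then have "R k (m1 * n1)" "R l (m2 * n2)" using a(3) R[OF *(5,6)] by simp_all
      with * have "((m1, n1), (m2, n2)) \<in> ?S" by (simp add: coprime_divisor_pairs_def)
      moreover have "(m, n) = ?f ((m1, n1), (m2, n2))" using * by simp
      ultimately show "(m, n) \<in> ?f ` ?S" by blast
    qed
  qed
  ultimately have "bij_betw ?f ?S (coprime_divisor_pairs R (k * l))" by (simp add: bij_betw_def)
  from bij_betw_same_card[OF this] show ?thesis by (simp only: card_cartesian_product)
qed

text \<open>One entry of the pair must be 1. The pair (1, 1) is assigned to the first set, whence
  \<open>0 < i\<close> in the second.\<close>

lemma coprime_divisor_pairs_prime_power:
  assumes p: "prime p"
  shows "coprime_divisor_pairs R (p ^ e) =
    (\<lambda>i. (p ^ i, 1)) ` {i. i \<le> e \<and> R (p ^ e) (p ^ i)} \<union>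
    (\<lambda>i. (1, p ^ i)) ` {i. 0 < i \<and> i \<le> e \<and> R (p ^ e) (p ^ i)}" (is "_ = ?A \<union> ?B")
proof
  show "?A \<union> ?B \<subseteq> coprime_divisor_pairs R (p ^ e)"
    by (auto simp: coprime_divisor_pairs_def le_imp_power_dvd)
  show "coprime_divisor_pairs R (p ^ e) \<subseteq> ?A \<union> ?B"
  proof
    fix x assume "x \<in> coprime_divisor_pairs R (p ^ e)"
    then obtain m n where x: "x = (m, n)" "coprime m n" "m * n dvd p ^ e" "R (p ^ e) (m * n)"
      by (auto simp: coprime_divisor_pairs_def)
    then obtain i j where ij: "m = p ^ i" "n = p ^ j" "i \<le> e" "j \<le> e"
      using p by (meson divides_primepow_nat dvd_mult_left dvd_mult_right)
    then have "i = 0 \<or> j = 0" using x(2) p by auto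
    then show "x \<in> ?A \<union> ?B" using x ij by (cases "j = 0") auto
  qed
qed

lemma card_coprime_divisor_pairs_prime_power:
  assumes p: "prime p"
  shows "card (coprime_divisor_pairs R (p ^ e)) =
    card {i. i \<le> e \<and> R (p ^ e) (p ^ i)} + card {i. 0 < i \<and> i \<le> e \<and> R (p ^ e) (p ^ i)}"
proof -
  have inj: "p ^ i = p ^ j \<longleftrightarrow> i = j" for i j
    using p prime_gt_1_nat by (metis power_inject_exp)
  have one: "Suc 0 = p ^ i \<longleftrightarrow> i = 0" for i
    using inj[of 0 i] by auto
  have "card ((\<lambda>i. (p ^ i, 1::nat)) ` X) = card X" "card ((\<lambda>i. (1::nat, p ^ i)) ` X) = card X" for X
    by (auto intro!: card_image inj_onI simp: inj)
  moreover have "finite {i. i \<le> e \<and> Q i}" "finite {i. 0 < i \<and> i \<le> e \<and> Q i}" for Q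
    by simp_all
  ultimately show ?thesis unfolding coprime_divisor_pairs_prime_power[OF p]
    by (subst card_Un_disjoint) (auto simp: one)
qed

text \<open>Each full prime power of \<open>k\<close> goes to one of the two factors, which gives
  two choices per prime.\<close>

lemma card_coprime_factorizations:
  assumes "k > 0"
  shows "card (coprime_divisor_pairs (\<lambda>k c. c = k) k) = 2 ^ card (prime_factors k)"
  using assms
proof (induction k rule: coprime_prime_power_induct)
  case one
  have "coprime_divisor_pairs (\<lambda>k c. c = k) 1 = {(1, 1)}"
    by (auto simp: coprime_divisor_pairs_def)
  then show ?case by simp
next
  case (mult p e k)
  have cop: "coprime (p ^ e) k"
    using mult.hyps prime_imp_power_coprime_nat coprime_commute by blast
  have inj: "p ^ i = p ^ j \<longleftrightarrow> i = j" for i j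
    using mult.hyps prime_gt_1_nat by (metis power_inject_exp)
  have "{i. i \<le> e \<and> i = e} = {e}" "{i. 0 < i \<and> i \<le> e \<and> i = e} = {e}" using mult.hyps by auto
  then have "card (coprime_divisor_pairs (\<lambda>k c. c = k) (p ^ e)) = 2"
    by (simp add: card_coprime_divisor_pairs_prime_power[OF mult.hyps(1)] inj)
  moreover have "prime_factors (p ^ e * k) = insert p (prime_factors k)"
    using mult.hyps by (auto simp: in_prime_factors_iff prime_dvd_mult_iff prime_dvd_power_iff
        primes_dvd_imp_eq prime_gt_0_nat)
  moreover have "p \<notin> prime_factors k" using mult.hyps by (simp add: in_prime_factors_iff)
  ultimately show ?case
    using mult.IH by (subst card_coprime_divisor_pairs_mult[OF cop])
      (simp_all add: mult_eq_mult_iff_coprime_nat[OF cop])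
qed

lemma card_T_eq_coprime_divisor_pairs:
  assumes "l > 0"
  shows "card (T l) = card (coprime_divisor_pairs (\<lambda>k c. even k \<longrightarrow> even c) l)"
proof -
  let ?R = "\<lambda>k c. even k \<longrightarrow> even (c::nat)"
  \<comment> \<open>For an even product the maximum is its 2-part, and a strict inequality means
    that \<open>c\<close> contributes a factor 2. For an odd product the left side reads 1 <
    2.\<close>
  have two: "two_part lam < max (two_part (c * lam)) 2 \<longleftrightarrow> (even (c * lam) \<longrightarrow> even c)"
    if "c > 0" "lam > 0" for c lam
  proof -
    have m: "multiplicity 2 (c * lam) = multiplicity 2 c + multiplicity 2 lam"
      using that by (simp add: prime_elem_multiplicity_mult_distrib)
    have pos: "multiplicity 2 x > 0 \<longleftrightarrow> even x" if "x > 0" for x :: nat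
      using that by (simp add: prime_multiplicity_gt_zero_iff)
    show ?thesis
    proof (cases "even (c * lam)")
      case True
      then have "multiplicity 2 (c * lam) > 0" using pos that by simp
      then have "two_part (c * lam) \<ge> 2" unfolding two_part_def
        using power_increasing[of 1 "multiplicity 2 (c * lam)" "2::nat"] by simp
      then have "two_part lam < max (two_part (c * lam)) 2 \<longleftrightarrow>
          multiplicity 2 lam < multiplicity 2 (c * lam)"
        by (simp add: two_part_def max_def)
      then show ?thesis using True m pos[OF that(1)] by auto
    next
      case False
      then have "multiplicity 2 lam = 0" using pos[OF that(2)] by auto
      then show ?thesis using False by (simp add: two_part_def)
    qed
  qed
  have "bij_betw (\<lambda>(m, n, lam). (m, n)) (T l) (coprime_divisor_pairs ?R l)"
  proof (rule bij_betw_byWitness[where f' = "\<lambda>(m, n). (m, n, l div (m * n))"])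
    show "\<forall>x\<in>T l. (\<lambda>(m, n). (m, n, l div (m * n))) ((\<lambda>(m, n, lam). (m, n)) x) = x"
      using assms by (auto simp: T_def)
    show "(\<lambda>(m, n, lam). (m, n)) ` T l \<subseteq> coprime_divisor_pairs ?R l"
    proof safe
      fix m n lam assume "(m, n, lam) \<in> T l"
      then show "(m, n) \<in> coprime_divisor_pairs ?R l"
        using two[of "m * n" lam] assms by (auto simp: T_def coprime_divisor_pairs_def)
    qed
    show "(\<lambda>(m, n). (m, n, l div (m * n))) ` coprime_divisor_pairs ?R l \<subseteq> T l"
    proof safe
      fix m n assume mn: "(m, n) \<in> coprime_divisor_pairs ?R l"
      then obtain lam where lam: "l = m * n * lam"
        by (auto simp: coprime_divisor_pairs_def elim: dvdE)
      then have "l div (m * n) = lam" using assms by auto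
      then show "(m, n, l div (m * n)) \<in> T l"
        using mn two[of "m * n" lam] assms lam by (auto simp: T_def coprime_divisor_pairs_def)
    qed
  qed auto
  then show ?thesis by (rule bij_betw_same_card)
qed

text \<open>An odd prime power admits \<open>2 * e i + 1\<close> local pairs, one nontrivial power
  on either side or (1, 1). At 2 the parity condition forbids (1, 1), leaving
  \<open>2 * e i\<close>.\<close>

lemma card_T_prod_prime_powers:
  assumes "finite I" "\<And>i. i \<in> I \<Longrightarrow> prime (p i)" "inj_on p I" "\<And>i. i \<in> I \<Longrightarrow> e i > 0"
  shows "card (T (\<Prod>i\<in>I. p i ^ e i)) = (\<Prod>i\<in>I. 2 * e i + (if p i = 2 then 0 else 1))"
proof -
  let ?R = "\<lambda>k c. even k \<longrightarrow> even (c::nat)"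
  have "card (coprime_divisor_pairs ?R (\<Prod>i\<in>I. p i ^ e i)) =
      (\<Prod>i\<in>I. 2 * e i + (if p i = 2 then 0 else 1))"
    using assms
  proof (induction I rule: finite_induct)
    case empty
    have "coprime_divisor_pairs ?R 1 = {(1, 1)}" by (auto simp: coprime_divisor_pairs_def)
    then show ?case by simp
  next
    case (insert j I)
    have pj: "prime (p j)" "e j > 0" using insert.prems by auto
    have "coprime (p j ^ e j) (p i ^ e i)" if "i \<in> I" for i
    proof -
      have "p i \<noteq> p j" using that insert by (auto simp: inj_on_def)
      then show ?thesis using insert.prems(1) that by (simp add: primes_coprime)
    qed
    then have cop: "coprime (p j ^ e j) (\<Prod>i\<in>I. p i ^ e i)"
      by (rule prod_coprime_right)
    have "card (coprime_divisor_pairs ?R (p j ^ e j)) = 2 * e j + (if p j = 2 then 0 else 1)"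
    proof (cases "p j = 2")
      case True
      have "{i. i \<le> e j \<and> 0 < i} = {1..e j}" "{i. 0 < i \<and> i \<le> e j \<and> 0 < i} = {1..e j}"
        by auto
      then show ?thesis
        using pj(2) True card_coprime_divisor_pairs_prime_power[OF two_is_prime_nat, of ?R "e j"]
        by simp
    next
      case False
      then have "odd (p j)" using pj(1) by (metis primes_dvd_imp_eq two_is_prime_nat)
      moreover have "{i. i \<le> e j} = {..e j}" "{i. 0 < i \<and> i \<le> e j} = {1..e j}" by auto
      ultimately show ?thesis
        using pj(2) False card_coprime_divisor_pairs_prime_power[OF pj(1), of ?R "e j"] by simp
    qed
    \<comment> \<open>The parity condition splits because at most one of the coprime factors is
      even, and a divisor of an odd number is odd.\<close>
    moreover have "?R (p j ^ e j * (\<Prod>i\<in>I. p i ^ e i)) (c * d) \<longleftrightarrow>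
        ?R (p j ^ e j) c \<and> ?R (\<Prod>i\<in>I. p i ^ e i) d"
      if "c dvd p j ^ e j" "d dvd (\<Prod>i\<in>I. p i ^ e i)" for c d
    proof -
      have "\<not> (even (p j ^ e j) \<and> even (\<Prod>i\<in>I. p i ^ e i))"
        using cop coprime_common_divisor by (metis odd_one)
      moreover have "odd c \<or> even (p j ^ e j)" "odd d \<or> even (\<Prod>i\<in>I. p i ^ e i)"
        using that by (meson dvd_trans)+
      ultimately show ?thesis by auto
    qed
    ultimately have "card (coprime_divisor_pairs ?R (p j ^ e j * (\<Prod>i\<in>I. p i ^ e i))) =
        (2 * e j + (if p j = 2 then 0 else 1)) *
        card (coprime_divisor_pairs ?R (\<Prod>i\<in>I. p i ^ e i))"
      by (subst card_coprime_divisor_pairs_mult[OF cop]) simp_all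
    then show ?case using insert by simp
  qed
  moreover have "(\<Prod>i\<in>I. p i ^ e i) > 0"
    using assms(2) by (auto intro!: prod_pos simp: prime_gt_0_nat)
  ultimately show ?thesis by (simp add: card_T_eq_coprime_divisor_pairs)
qed

section \<open>Enumeration\<close>

lemma coprime_gcd_Suc_nat: "coprime (gcd a l) (gcd (Suc a) (l::nat))"
  by (rule coprime_divisors[of _ a _ "Suc a"]) auto

text \<open>The two ends prescribe \<open>e\<close> modulo two coprime numbers, hence modulo their
  product. Each black-white pair thus owns one residue class, all of equal size.\<close>

lemma card_joining_edges_cyclic_dessin:
  assumes "a < l" "b < gcd a l" "w < gcd (Suc a) l"
  shows "card (joining_edges (cyclic_dessin l a) b w) = l div (gcd a l * gcd (Suc a) l)"
proof -
  let ?g = "gcd a l" and ?h = "gcd (Suc a) l"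
  have cop: "coprime ?g ?h" by (rule coprime_gcd_Suc_nat)
  have pos: "?g \<noteq> 0" "?h \<noteq> 0" using assms by auto
  have "?g * ?h dvd l" using cop by (simp add: divides_mult)
  then obtain q where q: "l = ?g * ?h * q" by (elim dvdE)
  from binary_chinese_remainder_unique_nat[OF cop pos, of b w]
  obtain r where r: "r < ?g * ?h" "[r = b] (mod ?g)" "[r = w] (mod ?h)" by auto
  have "e mod ?g = b \<and> e mod ?h = w \<longleftrightarrow> e mod (?g * ?h) = r" for e
  proof -
    have "e mod ?g = b \<and> e mod ?h = w \<longleftrightarrow> [e = r] (mod ?g) \<and> [e = r] (mod ?h)"
      using r assms by (simp add: cong_def)
    also have "\<dots> \<longleftrightarrow> [e = r] (mod (?g * ?h))"
      using cop coprime_cong_mult_nat cong_dvd_modulus_nat by (meson dvd_triv_left dvd_triv_right)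
    finally show ?thesis using r(1) by (simp add: cong_def)
  qed
  then have "joining_edges (cyclic_dessin l a) b w = {e. e < ?g * ?h * q \<and> e mod (?g * ?h) = r}"
    unfolding joining_edges_def q[symmetric] by auto
  then have "card (joining_edges (cyclic_dessin l a) b w) = q"
    using card_residue_class[OF r(1)] by simp
  moreover have "l div (?g * ?h) = q"
    using pos by (subst q) simp
  ultimately show ?thesis by simp
qed

lemma has_edge_multiplicity_cyclic_dessin_iff:
  assumes "a < l"
  shows "has_edge_multiplicity (cyclic_dessin l a) lam \<longleftrightarrow>
    l div (gcd a l * gcd (Suc a) l) = lam"
proof -
  have "gcd a l * gcd (Suc a) l dvd l" by (simp add: divides_mult coprime_gcd_Suc_nat)
  \<comment> \<open>Makes every pair adjacent, so the multiplicity condition applies to each;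
    positive gcds ensure that there is a pair at all.\<close>
  then have "l div (gcd a l * gcd (Suc a) l) > 0"
    using assms by (metis dvd_div_eq_0_iff gr0I not_less0)
  then have "joining_edges (cyclic_dessin l a) b w \<noteq> {}" if "b < gcd a l" "w < gcd (Suc a) l" for b w
    using card_joining_edges_cyclic_dessin[OF assms that] by force
  moreover have "0 < gcd a l" "0 < gcd (Suc a) l" using assms by auto
  ultimately show ?thesis
    unfolding has_edge_multiplicity_def
    using card_joining_edges_cyclic_dessin[OF assms] by (metis cyclic_dessin_simps(1,2) lessThan_iff)
qed

lemma underlying_complete_bipartite_cyclic_dessin_iff:
  assumes "a < l" "l = m * n * lam"
  shows "underlying_complete_bipartite (cyclic_dessin l a) m n lam \<longleftrightarrow>
    gcd a l = m \<and> gcd (Suc a) l = n"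
proof -
  have "m * n \<noteq> 0" using assms by (cases "m = 0"; cases "n = 0") auto
  then have "l div (m * n) = lam" by (simp add: assms(2))
  then show ?thesis
    using card_joining_edges_cyclic_dessin[OF assms(1)]
    by (auto simp: underlying_complete_bipartite_def)
qed

lemma card_U:
  assumes "l > 0"
  shows "card (U l) = l"
proof -
  let ?P = "\<lambda>D. unicellular D \<and> regular D \<and> has_face_length D (2 * l)"
  have "card (iso_classes ?P) = card {a. a < l \<and> ?P (cyclic_dessin l a)}"
    by (rule card_iso_classes)
      (auto simp: has_face_length_unicellular_iff unicellular_cyclic_dessin
        regular_cyclic_dessin dessin_cyclic_dessin)
  also have "{a. a < l \<and> ?P (cyclic_dessin l a)} = {..<l}"
    by (auto simp: has_face_length_unicellular_iff unicellular_cyclic_dessin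
        regular_cyclic_dessin dessin_cyclic_dessin)
  finally show ?thesis by (simp add: U_def)
qed

lemma card_K:
  assumes "l > 0" "l = m * n * lam"
  shows "card (K m n lam) = card (consecutive_gcds l m n)"
proof -
  let ?P = "\<lambda>D. unicellular D \<and> regular D \<and> underlying_complete_bipartite D m n lam"
  have "card (iso_classes ?P) = card {a. a < l \<and> ?P (cyclic_dessin l a)}"
    by (rule card_iso_classes)
      (auto simp: unicellular_cyclic_dessin regular_cyclic_dessin card_edges_complete_bipartite
        assms(2) dest: underlying_complete_bipartite_isomorphic[OF _ dessin_cyclic_dessin])
  also have "{a. a < l \<and> ?P (cyclic_dessin l a)} = consecutive_gcds l m n"
    unfolding consecutive_gcds_def
    using underlying_complete_bipartite_cyclic_dessin_iff[OF _ assms(2)]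
      unicellular_cyclic_dessin regular_cyclic_dessin by blast
  finally show ?thesis by (simp add: K_def)
qed

text \<open>The multiplicity determines only the product \<open>k\<close> of the vertex numbers; the
  residues are sorted by how \<open>k\<close> splits into coprime factors.\<close>

lemma card_U_mult:
  assumes "l > 0" "l = k * lam"
  shows "card (U_mult l lam) =
    (\<Sum>(m, n)\<in>coprime_divisor_pairs (\<lambda>k c. c = k) k. card (consecutive_gcds l m n))"
proof -
  let ?P = "\<lambda>D. unicellular D \<and> regular D \<and> has_face_length D (2 * l) \<and>
    has_edge_multiplicity D lam"
  let ?I = "coprime_divisor_pairs (\<lambda>k c. c = k) k"
  let ?C = "\<lambda>(m, n). consecutive_gcds l m n"
  have "card (iso_classes ?P) = card {a. a < l \<and> ?P (cyclic_dessin l a)}"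
    by (rule card_iso_classes)
      (auto simp: has_face_length_unicellular_iff unicellular_cyclic_dessin
        regular_cyclic_dessin dessin_cyclic_dessin
        dest: has_edge_multiplicity_isomorphic[OF _ dessin_cyclic_dessin])
  also have "{a. a < l \<and> ?P (cyclic_dessin l a)} =
      {a. a < l \<and> l div (gcd a l * gcd (Suc a) l) = lam}"
    by (auto simp: has_face_length_unicellular_iff unicellular_cyclic_dessin
        regular_cyclic_dessin dessin_cyclic_dessin has_edge_multiplicity_cyclic_dessin_iff)
  also have "\<dots> = (\<Union>x\<in>?I. ?C x)"
  proof -
    have "l div (gcd a l * gcd (Suc a) l) = lam \<longleftrightarrow> gcd a l * gcd (Suc a) l = k" for a
    proof -
      have "gcd a l * gcd (Suc a) l dvd l" by (simp add: divides_mult coprime_gcd_Suc_nat)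
      then obtain q where q: "l = gcd a l * gcd (Suc a) l * q" by (elim dvdE)
      have pos: "k > 0" "lam > 0" "gcd a l * gcd (Suc a) l > 0" using assms by auto
      then have "l div (gcd a l * gcd (Suc a) l) = q"
        by (metis q nonzero_mult_div_cancel_left less_not_refl)
      moreover have "q = lam \<longleftrightarrow> gcd a l * gcd (Suc a) l = k"
        using q assms(2) pos by (metis mult_cancel2 mult_cancel1 less_not_refl)
      ultimately show ?thesis by simp
    qed
    then show ?thesis
      by (auto simp: coprime_divisor_pairs_def consecutive_gcds_def coprime_gcd_Suc_nat)
  qed
  also have "card \<dots> = (\<Sum>x\<in>?I. card (?C x))"
  proof (rule card_UN_disjoint)
    have "k > 0" using assms by auto
    have "?I \<subseteq> {..k} \<times> {..k}"
      using \<open>k > 0\<close> by (auto simp: coprime_divisor_pairs_def)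
    then show "finite ?I" by (rule finite_subset) simp
  qed (auto simp: consecutive_gcds_def)
  finally show ?thesis by (simp add: U_mult_def case_prod_unfold)
qed

theorem mainTheorem2:
  fixes l m n lam :: nat and \<sigma> \<pi> :: "nat set"
  assumes "l > 0" and "(m, n, lam) \<in> T l"
  defines "\<sigma> \<equiv> prime_factors (l div lam)"
    and "\<pi> \<equiv> prime_factors lam - \<sigma>"
  shows "card (U l) = l \<and>
    (real (card (K m n lam)) = real (totient lam) * (\<Prod>p\<in>\<pi>. (real p - 2) / (real p - 1)) \<and>
     real (card (U_mult l lam)) =
       2 ^ card \<sigma> * real (totient lam) * (\<Prod>p\<in>\<pi>. (real p - 2) / (real p - 1))) \<and>
    (\<forall>s (p :: nat \<Rightarrow> nat) (e :: nat \<Rightarrow> nat).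
       (\<forall>i\<in>{1..s}. prime (p i) \<and> e i > 0) \<and> strict_mono_on {1..s} p \<and>
       l = (\<Prod>i=1..s. p i ^ e i) \<longrightarrow>
       card (T l) = (\<Prod>i=1..s. 2 * e i + (if i = 1 then (if even l then 0 else 1) else 1)))"
proof (intro conjI allI impI)
  show "card (U l) = l" using assms(1) by (rule card_U)
next
  define r where "r = (\<Prod>p\<in>\<pi>. (real p - 2) / (real p - 1))"
  have T: "l = m * n * lam" "coprime m n" using assms(2) by (auto simp: T_def)
  have "lam > 0" using T assms(1) by (cases lam) auto
  then have k: "l div lam = m * n" by (simp add: T(1))
  \<comment> \<open>The value depends on the pair only through its product, so all summands below
    are equal.\<close>
  have count: "real (card (consecutive_gcds l m' n')) = real (totient lam) * r"
    if "coprime m' n'" "m' * n' = m * n" for m' n'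
    using card_consecutive_gcds[of l m' n' lam] that assms(1) T
    by (simp add: r_def \<pi>_def \<sigma>_def k)
  show "real (card (K m n lam)) = real (totient lam) * r"
    using card_K[OF assms(1) T(1)] count T(2) by simp
  let ?I = "coprime_divisor_pairs (\<lambda>k c. c = k) (m * n)"
  have "real (card (U_mult l lam)) = (\<Sum>(m', n')\<in>?I. real (card (consecutive_gcds l m' n')))"
    unfolding card_U_mult[OF assms(1) T(1)] by (simp add: case_prod_unfold)
  also have "\<dots> = (\<Sum>x\<in>?I. real (totient lam) * r)"
    by (intro sum.cong) (auto simp: coprime_divisor_pairs_def intro!: count)
  also have "\<dots> = real (card ?I) * (real (totient lam) * r)" by simp
  also have "card ?I = 2 ^ card \<sigma>"
    using card_coprime_factorizations[of "m * n"] assms(1) T(1) by (simp add: \<sigma>_def k)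
  finally show "real (card (U_mult l lam)) = 2 ^ card \<sigma> * real (totient lam) * r"
    by simp
next
  fix s :: nat and p e :: "nat \<Rightarrow> nat"
  assume asm: "(\<forall>i\<in>{1..s}. prime (p i) \<and> e i > 0) \<and> strict_mono_on {1..s} p \<and>
    l = (\<Prod>i=1..s. p i ^ e i)"
  then have pr: "\<And>i. i \<in> {1..s} \<Longrightarrow> prime (p i)" "\<And>i. i \<in> {1..s} \<Longrightarrow> e i > 0"
    and mono: "strict_mono_on {1..s} p" and l: "l = (\<Prod>i=1..s. p i ^ e i)" by auto
  have inj: "inj_on p {1..s}" using mono by (rule strict_mono_on_imp_inj_on)
  \<comment> \<open>The primes increase, so 2 can only be the first of them; this turns the
    exception at the prime 2 into one at the index 1.\<close>
  have "p i = 2 \<longleftrightarrow> i = 1 \<and> even l" if i: "i \<in> {1..s}" for i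
  proof
    assume "p i = 2"
    moreover have "p 1 < p i" if "i \<noteq> 1"
      using mono i that by (auto intro: strict_mono_onD)
    moreover have "2 \<le> p 1" using pr(1)[of 1] i by (auto intro: prime_ge_2_nat)
    moreover have "p i ^ e i dvd l" unfolding l using i by (intro dvd_prodI) auto
    then have "p i dvd l" using pr(2)[OF i] by (meson dvd_power dvd_trans)
    ultimately show "i = 1 \<and> even l" by auto
  next
    assume a: "i = 1 \<and> even l"
    then obtain j where j: "j \<in> {1..s}" "even (p j ^ e j)"
      unfolding l by (auto simp: prime_dvd_prod_iff)
    then have "p j = 2" using pr(1) primes_dvd_imp_eq[OF two_is_prime_nat] by fastforce
    then have "j = 1"
      using mono j i a prime_ge_2_nat[OF pr(1)[OF i]] strict_mono_onD[OF mono i j(1)] by force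
    with \<open>p j = 2\<close> a show "p i = 2" by simp
  qed
  then have "(\<Prod>i=1..s. 2 * e i + (if p i = 2 then 0 else 1)) =
      (\<Prod>i=1..s. 2 * e i + (if i = 1 then (if even l then 0 else 1) else 1))"
    by (intro prod.cong) auto
  then show "card (T l) =
      (\<Prod>i=1..s. 2 * e i + (if i = 1 then (if even l then 0 else 1) else 1))"
    using card_T_prod_prime_powers[OF _ pr(1) inj pr(2)] l by simp
qed

end
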